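(* Let $X$ be an infinite-dimensional complex Banach space and $T\in\mathcal{B}(X)$ a bounded operator such that $\sigma(T)$ is countable and $\sigma_p(T)=\emptyset$. Then for any nonzero $x\in X$ and any $\varepsilon>0$ there exists $F\in\mathcal{B}(X)$ with $\|F\|<\varepsilon$ and $\operatorname{Range}(F)=[x]$, and such that $T-F$ admits an invariant halfspace, say $Y$. In this case, $TY\subseteq Y+[x]$.
   Context: $\mathcal{B}(X)$ is the algebra of bounded linear operators on $X$; $\sigma(T)$ is the spectrum and $\sigma_p(T)=\{\lambda\in\mathbb{C}:\lambda-T\text{ is not injective}\}$ the point spectrum. $[x]$ denotes the linear span of $x$. A halfspace of $X$ is a norm-closed subspace $Y$ with $\dim(Y)=\dim(X/Y)=\infty$. An invariant halfspace under $R\in\mathcal{B}(X)$ is a halfspace $Y$ with $RY\subseteq Y$. *)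

theory Defs
  imports "HOL-Analysis.Analysis"
begin

class scaleC =
  fixes scaleC :: "complex \<Rightarrow> 'a \<Rightarrow> 'a" (infixr "*\<^sub>C" 75)

text \<open>The real structure of a complex normed space is the restriction of its complex one, so
  that the library's real notions (\<open>closed\<close>, \<open>bounded_linear\<close>, \<open>\<Rightarrow>\<^sub>L\<close> and the operator norm) apply.\<close>

class complex_normed_vector = real_normed_vector + scaleC +
  assumes scaleC_add_right: "a *\<^sub>C (x + y) = a *\<^sub>C x + a *\<^sub>C y"
    and scaleC_add_left: "(a + b) *\<^sub>C x = a *\<^sub>C x + b *\<^sub>C x"
    and scaleC_scaleC: "a *\<^sub>C (b *\<^sub>C x) = (a * b) *\<^sub>C x"
    and scaleC_one: "1 *\<^sub>C x = x"
    and scaleR_scaleC: "r *\<^sub>R x = complex_of_real r *\<^sub>C x"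
    and norm_scaleC: "norm (a *\<^sub>C x) = cmod a * norm x"

class complex_banach = complex_normed_vector + banach

global_interpretation complex_vector: vector_space
  "scaleC :: complex \<Rightarrow> 'a \<Rightarrow> 'a :: complex_normed_vector"
  by standard (rule scaleC_add_right scaleC_add_left scaleC_scaleC scaleC_one)+

lemma bounded_linear_scaleC: "bounded_linear (\<lambda>x :: 'a :: complex_normed_vector. c *\<^sub>C x)"
  by (rule bounded_linear_intro[where K = "cmod c"])
    (simp_all add: scaleC_add_right scaleR_scaleC scaleC_scaleC norm_scaleC mult.commute)

instantiation blinfun :: (real_normed_vector, complex_normed_vector) complex_normed_vector
begin

lift_definition scaleC_blinfun :: "complex \<Rightarrow> 'a \<Rightarrow>\<^sub>L 'b \<Rightarrow> 'a \<Rightarrow>\<^sub>L 'b" is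
  "\<lambda>c f x. c *\<^sub>C f x"
  by (rule bounded_linear_compose[OF bounded_linear_scaleC])

instance
proof
  fix a b :: complex and r :: real and f g :: "'a \<Rightarrow>\<^sub>L 'b"
  show "a *\<^sub>C (f + g) = a *\<^sub>C f + a *\<^sub>C g"
    by transfer (simp add: scaleC_add_right)
  show "(a + b) *\<^sub>C f = a *\<^sub>C f + b *\<^sub>C f"
    by transfer (simp add: scaleC_add_left)
  show "a *\<^sub>C (b *\<^sub>C f) = (a * b) *\<^sub>C f"
    by transfer (simp add: scaleC_scaleC)
  show one: "1 *\<^sub>C f = f" for f :: "'a \<Rightarrow>\<^sub>L 'b"
    by transfer (simp add: scaleC_one)
  show "r *\<^sub>R f = complex_of_real r *\<^sub>C f"
    by transfer (simp add: scaleR_scaleC)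
  have le: "norm (c *\<^sub>C h) \<le> cmod c * norm h" for c and h :: "'a \<Rightarrow>\<^sub>L 'b"
  proof (rule norm_blinfun_bound)
    show "norm (blinfun_apply (c *\<^sub>C h) x) \<le> cmod c * norm h * norm x" for x
      using mult_left_mono[OF norm_blinfun[of h x], of "cmod c"]
      by (simp add: scaleC_blinfun.rep_eq norm_scaleC mult.assoc)
  qed simp
  show "norm (a *\<^sub>C f) = cmod a * norm f"
  proof (cases "a = 0")
    case True
    then show ?thesis using le[of a f] by simp
  next
    case False
    have "inverse a *\<^sub>C (a *\<^sub>C f) = (1 :: complex) *\<^sub>C f"
      using False by transfer (simp add: scaleC_scaleC)
    then have "norm f \<le> cmod (inverse a) * norm (a *\<^sub>C f)"
      using le[of "inverse a" "a *\<^sub>C f"] by (simp add: one)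
    then have "cmod a * norm f \<le> norm (a *\<^sub>C f)"
      using False by (simp add: norm_inverse norm_divide field_simps)
    then show ?thesis using le[of a f] by simp
  qed
qed

end

text \<open>The algebra of bounded complex-linear operators on \<open>X\<close>; the type \<open>\<Rightarrow>\<^sub>L\<close> alone only gives
  real-linearity. The norm inherited from \<open>\<Rightarrow>\<^sub>L\<close> is the operator norm.\<close>

definition bounded_operators :: "('a::complex_normed_vector \<Rightarrow>\<^sub>L 'a) set" where
  "bounded_operators = {T. Vector_Spaces.linear scaleC scaleC (blinfun_apply T)}"

definition spectrum :: "('a::complex_normed_vector \<Rightarrow>\<^sub>L 'a) \<Rightarrow> complex set" where
  "spectrum T = {l. \<not> (\<exists>S\<in>bounded_operators.
      S o\<^sub>L (l *\<^sub>C id_blinfun - T) = id_blinfun \<and> (l *\<^sub>C id_blinfun - T) o\<^sub>L S = id_blinfun)}"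

definition point_spectrum :: "('a::complex_normed_vector \<Rightarrow>\<^sub>L 'a) \<Rightarrow> complex set" where
  "point_spectrum T = {l. \<not> inj (blinfun_apply (l *\<^sub>C id_blinfun - T))}"

definition infinite_dim :: "'a::complex_normed_vector set \<Rightarrow> bool" where
  "infinite_dim V \<longleftrightarrow> \<not> (\<exists>B. finite B \<and> complex_vector.span B = V)"

text \<open>The quotient \<open>X/Y\<close> depends on the set \<open>Y\<close>, so it is a set of cosets rather than a type. Its
  operations are \<open>(u + Y) + (v + Y) = (u + v) + Y\<close> and \<open>c (u + Y) = c u + Y\<close>; the linear span in
  \<open>X/Y\<close> of a set \<open>S\<close> of cosets is generated with respect to these.\<close>

definition coset :: "'a::complex_normed_vector set \<Rightarrow> 'a \<Rightarrow> 'a set" where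
  "coset Y u = (\<lambda>y. u + y) ` Y"

definition quotient_space :: "'a::complex_normed_vector set \<Rightarrow> 'a set set" where
  "quotient_space Y = range (coset Y)"

inductive_set quotient_span :: "'a::complex_normed_vector set \<Rightarrow> 'a set set \<Rightarrow> 'a set set"
  for Y :: "'a set" and S :: "'a set set" where
  zero: "coset Y 0 \<in> quotient_span Y S"
| base: "A \<in> S \<Longrightarrow> A \<in> quotient_span Y S"
| add: "coset Y u \<in> quotient_span Y S \<Longrightarrow> coset Y v \<in> quotient_span Y S \<Longrightarrow>
    coset Y (u + v) \<in> quotient_span Y S"
| scale: "coset Y u \<in> quotient_span Y S \<Longrightarrow> coset Y (c *\<^sub>C u) \<in> quotient_span Y S"

definition infinite_dim_quotient :: "'a::complex_normed_vector set \<Rightarrow> bool" where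
  "infinite_dim_quotient Y \<longleftrightarrow>
    \<not> (\<exists>S. finite S \<and> S \<subseteq> quotient_space Y \<and> quotient_span Y S = quotient_space Y)"

definition halfspace :: "'a::complex_normed_vector set \<Rightarrow> bool" where
  "halfspace Y \<longleftrightarrow>
    complex_vector.subspace Y \<and> closed Y \<and> infinite_dim Y \<and> infinite_dim_quotient Y"

definition invariant_halfspace ::
    "('a::complex_normed_vector \<Rightarrow>\<^sub>L 'a) \<Rightarrow> 'a set \<Rightarrow> bool" where
  "invariant_halfspace R Y \<longleftrightarrow> halfspace Y \<and> blinfun_apply R ` Y \<subseteq> Y"

end

theory Submission
  imports Defs "HOL-Complex_Analysis.Great_Picard"
begin

text \<open>
  Write \<open>R m = (m - T)\<^sup>-\<^sup>1\<close> for the resolvent. The idea is to look for the perturbation in the form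
  \<open>F z = - \<phi> z *\<^sub>C x\<close> with a small bounded functional \<open>\<phi>\<close>. Since \<open>T (R m x) = m *\<^sub>C R m x - x\<close>, the
  vector \<open>R m x\<close> is an eigenvector of \<open>T - F\<close> for the eigenvalue \<open>m\<close> as soon as \<open>\<phi> (R m x) = 1\<close>.
  So everything depends on how often the scalar holomorphic function \<open>m \<mapsto> \<phi> (R m x)\<close> takes a given
  large value, and Picard's great theorem answers this near an essential singularity.

  To find an essential singularity, consider the set of points near which \<open>m \<mapsto> R m x\<close> is unbounded.
  It is a closed subset of the countable spectrum, and it is nonempty because otherwise, by Liouville,
  the local resolvent would vanish. Hence it has an isolated point \<open>a\<close>. Away from this set
  \<open>\<phi> (R m x)\<close> extends holomorphically across the remaining, countably many points of the spectrum
  (\<open>holomorphic_extend_across_countable\<close>), so \<open>a\<close> is an isolated singularity for every \<open>\<phi>\<close>. If it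
  were a pole or removable for every \<open>\<phi>\<close>, then the Baire category theorem in the dual space would give
  a common bound \<open>norm (R m x) \<le> C / cmod (m - a) ^ N\<close> (\<open>weak_power_bound_imp_power_bound\<close>). The least
  such \<open>N\<close> is positive, since \<open>R m x\<close> is unbounded near \<open>a\<close>; for it the vectors \<open>(m - a) ^ N *\<^sub>C R m x\<close> converge, as \<open>m\<close> tends to \<open>a\<close>, to an element of
  the kernel of \<open>a - T\<close>; this kernel is zero as the point spectrum is empty, so that \<open>N\<close> could be lowered
  (\<open>local_resolvent_no_power_bound\<close>). Thus some \<open>\<phi>\<close> produces an essential singularity.

  By Picard every value \<open>w\<close>, with at most one exception, is taken infinitely often near \<open>a\<close>, and all
  but countably many \<open>w\<close> are taken only at points \<open>m\<close> of the resolvent set where the derivative \<open>- \<phi> (R m (R m x))\<close> is nonzero.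
  Dividing \<open>\<phi>\<close> by such a \<open>w\<close> of large modulus makes it small and gives
  infinitely many eigenvectors \<open>h n = R (\<mu> n) x\<close> of \<open>T - F\<close>
  (\<open>simple_rank_one_eigenvalues\<close>). The functionals \<open>z \<mapsto> \<phi> (R (\<mu> n) z)\<close> are the eigenvectors of the
  adjoint; by the resolvent identity they vanish on \<open>h m\<close> for \<open>m \<noteq> n\<close>, and on \<open>h n\<close> they are nonzero
  because the derivative is. A biorthogonal sequence yields a halfspace, namely the closed span of
  every other \<open>h n\<close> (\<open>halfspace_closed_span_biorthogonal\<close>).
\<close>

section \<open>Norming functionals\<close>

text \<open>Asking for homogeneity as an inequality and for positive scalars only leaves less to check for the
  infima below; equality and \<open>p 0 = 0\<close> follow.\<close>

definition sublinear :: "('a::real_vector \<Rightarrow> real) \<Rightarrow> bool" where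
  "sublinear p \<longleftrightarrow> (\<forall>x y. p (x + y) \<le> p x + p y) \<and> (\<forall>t>0. \<forall>x. p (t *\<^sub>R x) \<le> t * p x)"

lemma sublinear_add: "sublinear p \<Longrightarrow> p (x + y) \<le> p x + p y"
  by (simp add: sublinear_def)

lemma sublinear_zero: assumes "sublinear p" shows "p 0 = 0"
proof -
  have "p (t *\<^sub>R 0) \<le> t * p 0" if "t > 0" for t
    using assms that by (simp only: sublinear_def)
  from this[of 2] this[of "1/2"] show ?thesis by simp
qed

lemma sublinear_scale:
  assumes "sublinear p" "t > 0" shows "p (t *\<^sub>R x) = t * p x"
proof (rule antisym)
  show "p (t *\<^sub>R x) \<le> t * p x" using assms by (simp add: sublinear_def)
  have "p ((1/t) *\<^sub>R (t *\<^sub>R x)) \<le> (1/t) * p (t *\<^sub>R x)"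
    using assms unfolding sublinear_def by (metis zero_less_divide_1_iff)
  then show "t * p x \<le> p (t *\<^sub>R x)" using assms(2) by (simp add: field_simps)
qed

lemma sublinear_uminus: assumes "sublinear p" shows "- p (- x) \<le> p x"
  using sublinear_add[OF assms, of x "- x"] sublinear_zero[OF assms] by simp

text \<open>Replacing \<open>p\<close> by \<open>x \<mapsto> inf {p (x + t y) - t p y | t \<ge> 0}\<close> forces additivity along the direction
  \<open>y\<close>. Used twice: to show that a minimal sublinear functional is odd, and to prescribe the value of
  the linear functional at one point.\<close>

lemma sublinear_decrease:
  fixes p :: "'a::real_vector \<Rightarrow> real"
  assumes p: "sublinear p"
  obtains q where "sublinear q" "\<And>x. q x \<le> p x" "q (- y) \<le> - p y"
proof
  define f where "f x t = p (x + t *\<^sub>R y) - t * p y" for x t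
  define q where "q x = (INF t\<in>{0..}. f x t)" for x
  have ty: "p (t *\<^sub>R y) = t * p y" if "t \<ge> 0" for t
    using sublinear_scale[OF p, of t y] sublinear_zero[OF p] that by (cases "t = 0") auto
  have bdd: "bdd_below (f x ` {0..})" for x
  proof (rule bdd_belowI2)
    fix t :: real assume "t \<in> {0..}"
    then show "- p (- x) \<le> f x t"
      using sublinear_add[OF p, of "x + t *\<^sub>R y" "- x"] ty[of t] by (simp add: f_def)
  qed
  have le: "q x \<le> f x t" if "t \<ge> 0" for x t
    unfolding q_def using bdd that by (intro cINF_lower) auto
  have ge: "c \<le> q x" if "\<And>t. t \<ge> 0 \<Longrightarrow> c \<le> f x t" for c x
    unfolding q_def using that by (intro cINF_greatest) auto
  show "sublinear q"
    unfolding sublinear_def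
  proof (intro conjI allI impI)
    fix u v
    have sum: "q (u + v) \<le> f u s + f v t" if "s \<ge> 0" "t \<ge> 0" for s t
    proof -
      have "q (u + v) \<le> f (u + v) (s + t)" using that by (intro le) auto
      also have "\<dots> \<le> f u s + f v t"
        using sublinear_add[OF p, of "u + s *\<^sub>R y" "v + t *\<^sub>R y"]
        by (simp add: f_def algebra_simps)
      finally show ?thesis .
    qed
    have "q (u + v) - f u s \<le> q v" if "s \<ge> 0" for s
      using sum[OF that] by (intro ge) (smt (verit))
    then have "q (u + v) - q v \<le> q u" by (intro ge) (smt (verit))
    then show "q (u + v) \<le> q u + q v" by simp
  next
    fix s :: real and u assume s: "s > 0"
    have "q (s *\<^sub>R u) / s \<le> f u t" if "t \<ge> 0" for t
    proof -
      have "q (s *\<^sub>R u) \<le> f (s *\<^sub>R u) (s * t)" using s that by (intro le) auto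
      also have "\<dots> = s * f u t"
        using sublinear_scale[OF p s, of "u + t *\<^sub>R y"] by (simp add: f_def algebra_simps)
      finally show ?thesis using s by (simp add: field_simps)
    qed
    then have "q (s *\<^sub>R u) / s \<le> q u" by (rule ge)
    then show "q (s *\<^sub>R u) \<le> s * q u" using s by (simp add: field_simps)
  qed
  show "q x \<le> p x" for x using le[of 0 x] by (simp add: f_def)
  show "q (- y) \<le> - p y" using le[of 1 "- y"] sublinear_zero[OF p] by (simp add: f_def)
qed

text \<open>The Hahn-Banach theorem for the zero subspace. A sublinear functional that is minimal for the
  pointwise order exists by Zorn's lemma, and it equals each of its decreases, so it is odd and
  hence linear.\<close>

lemma linear_below_sublinear:
  fixes p :: "'a::real_vector \<Rightarrow> real"
  assumes p: "sublinear p"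
  obtains l where "linear l" "\<And>x. l x \<le> p x"
proof -
  define A where "A = {q. sublinear q \<and> q \<le> p}"
  have "\<exists>m\<in>A. \<forall>a\<in>A. a \<le> m \<longrightarrow> a = m"
  proof (rule predicate_Zorn[where P = "\<lambda>a b. b \<le> a"])
    show "partial_order_on A (relation_of (\<lambda>a b. b \<le> a) A)"
      by (rule partial_order_on_relation_ofI) auto
  next
    fix C assume C: "C \<in> Chains (relation_of (\<lambda>a b. b \<le> a) A)"
    have CA: "C \<subseteq> A" and chain: "\<And>a b. a \<in> C \<Longrightarrow> b \<in> C \<Longrightarrow> a \<le> b \<or> b \<le> a"
      using C by (auto simp: Chains_def relation_of_def)
    show "\<exists>u\<in>A. \<forall>a\<in>C. u \<le> a"
    proof (cases "C = {}")
      case True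
      then show ?thesis using p by (auto simp: A_def)
    next
      case False
      define u where "u x = (INF a\<in>C. a x)" for x
      have lower: "- p (- x) \<le> a x" if "a \<in> C" for a x
      proof -
        have "sublinear a" "a (- x) \<le> p (- x)" using that CA by (auto simp: A_def le_fun_def)
        then show ?thesis using sublinear_uminus[of a x] by linarith
      qed
      have le: "u x \<le> a x" if "a \<in> C" for a x
        unfolding u_def using that lower by (intro cINF_lower bdd_belowI2) auto
      have ge: "c \<le> u x" if "\<And>a. a \<in> C \<Longrightarrow> c \<le> a x" for c x
        unfolding u_def using that False by (intro cINF_greatest) auto
      have sl: "sublinear a" if "a \<in> C" for a using that CA by (auto simp: A_def)
      have "sublinear u"
        unfolding sublinear_def
      proof (intro conjI allI impI)
        fix x y
        have sum: "u (x + y) \<le> a x + b y" if ab: "a \<in> C" "b \<in> C" for a b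
        proof -
          consider "a \<le> b" | "b \<le> a" using chain ab by blast
          then show ?thesis
          proof cases
            case 1
            then show ?thesis
              using le[OF ab(1), of "x + y"] sublinear_add[OF sl[OF ab(1)], of x y] le_funD[OF 1, of y]
              by linarith
          next
            case 2
            then show ?thesis
              using le[OF ab(2), of "x + y"] sublinear_add[OF sl[OF ab(2)], of x y] le_funD[OF 2, of x]
              by linarith
          qed
        qed
        have "u (x + y) - a x \<le> u y" if "a \<in> C" for a
          using sum[OF that] by (intro ge) (smt (verit))
        then have "u (x + y) - u y \<le> u x" by (intro ge) (smt (verit))
        then show "u (x + y) \<le> u x + u y" by simp
      next
        fix t :: real and x assume t: "t > 0"
        have "u (t *\<^sub>R x) / t \<le> a x" if "a \<in> C" for a
          using le[OF that, of "t *\<^sub>R x"] sublinear_scale[OF sl[OF that] t, of x] t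
          by (simp add: field_simps)
        then have "u (t *\<^sub>R x) / t \<le> u x" by (rule ge)
        then show "u (t *\<^sub>R x) \<le> t * u x" using t by (simp add: field_simps)
      qed
      moreover have "u \<le> p"
      proof -
        obtain a where a: "a \<in> C" using False by blast
        then have "a x \<le> p x" for x using CA by (auto simp: A_def le_fun_def)
        then show ?thesis using le[OF a] order_trans unfolding le_fun_def by blast
      qed
      ultimately show ?thesis using le by (auto simp: A_def le_fun_def)
    qed
  qed
  then obtain m where m: "sublinear m" "m \<le> p"
    and min: "\<And>a. sublinear a \<Longrightarrow> a \<le> p \<Longrightarrow> a \<le> m \<Longrightarrow> a = m"
    by (auto simp: A_def)
  have odd: "m (- y) = - m y" for y
  proof -
    obtain q where q: "sublinear q" "\<And>x. q x \<le> m x" "q (- y) \<le> - m y"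
      using sublinear_decrease[OF m(1)] by blast
    have "q = m" using q m(2) by (intro min) (auto simp: le_fun_def intro: order_trans)
    then show ?thesis using q(3) sublinear_uminus[OF m(1), of y] by simp
  qed
  have "linear m"
  proof (rule linearI)
    fix x y
    show "m (x + y) = m x + m y"
      using sublinear_add[OF m(1), of x y] sublinear_add[OF m(1), of "- x" "- y"]
        odd[of x] odd[of y] odd[of "x + y"] by (simp add: algebra_simps)
  next
    fix t :: real and x
    consider "t > 0" | "t = 0" | "t < 0" by linarith
    then show "m (t *\<^sub>R x) = t *\<^sub>R m x"
    proof cases
      case 3
      then show ?thesis
        using sublinear_scale[OF m(1), of "- t" x] odd[of "t *\<^sub>R x"] by simp
    qed (auto simp: sublinear_scale[OF m(1)] sublinear_zero[OF m(1)])
  qed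
  then show thesis using that m(2) by (auto simp: le_fun_def)
qed

text \<open>The norm is first decreased in the direction \<open>z\<close>, so that every linear functional below the result
  is at most \<open>- norm z\<close> at \<open>- z\<close>.\<close>

lemma norming_functional_real:
  fixes z :: "'a::real_normed_vector"
  obtains l :: "'a \<Rightarrow> real" where "bounded_linear l" "\<And>x. \<bar>l x\<bar> \<le> norm x" "l z = norm z"
proof -
  have "sublinear (norm :: 'a \<Rightarrow> real)" by (auto simp: sublinear_def norm_triangle_ineq)
  then obtain q where q: "sublinear q" "\<And>x. q x \<le> norm x" "q (- z) \<le> - norm z"
    using sublinear_decrease by blast
  obtain l where l: "linear l" "\<And>x. l x \<le> q x" using linear_below_sublinear[OF q(1)] by blast
  have le: "l x \<le> norm x" for x using l(2) q(2) order_trans by blast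
  have neg: "l (- x) = - l x" for x using l(1) by (rule linear_neg)
  have abs: "\<bar>l x\<bar> \<le> norm x" for x using le[of x] le[of "- x"] neg[of x] by simp
  show thesis
  proof
    show "bounded_linear l"
      using l(1) abs by (intro bounded_linear_intro[where K = 1]) (auto simp: linear_add linear_scale)
    show "\<bar>l x\<bar> \<le> norm x" for x by (rule abs)
    show "l z = norm z" using l(2)[of "- z"] q(3) neg[of z] le[of z] by simp
  qed
qed

definition clinear_functional :: "('a::complex_normed_vector \<Rightarrow> complex) \<Rightarrow> bool" where
  "clinear_functional \<phi> \<longleftrightarrow> bounded_linear \<phi> \<and> (\<forall>c z. \<phi> (c *\<^sub>C z) = c * \<phi> z)"

lemma clinear_functionalD:
  assumes "clinear_functional \<phi>"
  shows "bounded_linear \<phi>" "\<phi> (c *\<^sub>C z) = c * \<phi> z" "\<phi> (u + v) = \<phi> u + \<phi> v" "\<phi> (u - v) = \<phi> u - \<phi> v"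
    "\<phi> 0 = 0" "\<phi> (- u) = - \<phi> u"
  using assms
  by (auto simp: clinear_functional_def linear_simps)

lemma clinear_functional_complexify:
  fixes l :: "'a::complex_normed_vector \<Rightarrow> real"
  assumes "bounded_linear l"
  shows "clinear_functional (\<lambda>z. complex_of_real (l z) - \<i> * complex_of_real (l (\<i> *\<^sub>C z)))"
  unfolding clinear_functional_def
proof (intro conjI allI)
  interpret bounded_linear l by fact
  show "bounded_linear (\<lambda>z. complex_of_real (l z) - \<i> * complex_of_real (l (\<i> *\<^sub>C z)))"
    by (intro bounded_linear_sub bounded_linear_const_mult bounded_linear_compose[OF bounded_linear_of_real]
        assms bounded_linear_compose[OF assms bounded_linear_scaleC])
  fix c and z :: 'a
  have c: "c = complex_of_real (Re c) + complex_of_real (Im c) * \<i>" by (simp add: complex_eq mult.commute)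
  have "c *\<^sub>C z = (complex_of_real (Re c) + complex_of_real (Im c) * \<i>) *\<^sub>C z"
    using c by (rule arg_cong)
  also have "\<dots> = Re c *\<^sub>R z + Im c *\<^sub>R (\<i> *\<^sub>C z)"
    by (simp only: scaleC_add_left scaleR_scaleC scaleC_scaleC)
  finally have "c *\<^sub>C z = Re c *\<^sub>R z + Im c *\<^sub>R (\<i> *\<^sub>C z)" .
  moreover have "\<i> *\<^sub>C (c *\<^sub>C z) = Re c *\<^sub>R (\<i> *\<^sub>C z) + (- Im c) *\<^sub>R z"
  proof -
    have "\<i> * c = complex_of_real (Re c) * \<i> + complex_of_real (- Im c)"
      by (simp add: complex_eq_iff)
    then show ?thesis by (simp only: scaleC_add_left scaleR_scaleC scaleC_scaleC)
  qed
  ultimately have "l (c *\<^sub>C z) = Re c * l z + Im c * l (\<i> *\<^sub>C z)"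
    "l (\<i> *\<^sub>C (c *\<^sub>C z)) = Re c * l (\<i> *\<^sub>C z) - Im c * l z"
    by (simp_all add: add scaleR diff)
  then show "complex_of_real (l (c *\<^sub>C z)) - \<i> * complex_of_real (l (\<i> *\<^sub>C (c *\<^sub>C z))) =
      c * (complex_of_real (l z) - \<i> * complex_of_real (l (\<i> *\<^sub>C z)))"
    by (simp add: complex_eq_iff algebra_simps)
qed

text \<open>The crude constant \<open>2\<close> comes from estimating the real and the imaginary part separately; any constant
  that does not depend on \<open>z\<close> serves the estimates below.\<close>

lemma norming_functional:
  fixes z :: "'a::complex_normed_vector"
  obtains \<phi> where "clinear_functional \<phi>" "\<And>y. cmod (\<phi> y) \<le> 2 * norm y" "norm z \<le> cmod (\<phi> z)"
proof -
  obtain l :: "'a \<Rightarrow> real" where l: "bounded_linear l" "\<And>x. \<bar>l x\<bar> \<le> norm x" "l z = norm z"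
    using norming_functional_real by blast
  define \<phi> where "\<phi> y = complex_of_real (l y) - \<i> * complex_of_real (l (\<i> *\<^sub>C y))" for y
  show thesis
  proof
    show "clinear_functional \<phi>" unfolding \<phi>_def by (rule clinear_functional_complexify[OF l(1)])
    show "cmod (\<phi> y) \<le> 2 * norm y" for y
    proof -
      have "cmod (\<phi> y) \<le> \<bar>l y\<bar> + \<bar>l (\<i> *\<^sub>C y)\<bar>"
        unfolding \<phi>_def by (rule order_trans[OF norm_triangle_ineq4]) (simp add: norm_mult)
      then show ?thesis using l(2)[of y] l(2)[of "\<i> *\<^sub>C y"] by (simp add: norm_scaleC)
    qed
    show "norm z \<le> cmod (\<phi> z)"
      using l(3) complex_Re_le_cmod[of "\<phi> z"] by (simp add: \<phi>_def)
  qed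
qed

lemma clinear_functional_bound:
  assumes "clinear_functional \<phi>"
  obtains K where "K > 0" "\<And>z. cmod (\<phi> z) \<le> K * norm z"
  using bounded_linear.pos_bounded[OF clinear_functionalD(1)[OF assms]] by (metis mult.commute)

section \<open>Bounded holomorphic functions off a countable closed set\<close>

lemma open_countable_empty:
  fixes S :: "complex set"
  assumes "open S" "countable S"
  shows "S = {}"
proof (rule ccontr)
  assume "S \<noteq> {}"
  then obtain z r where "r > 0" "ball z r \<subseteq> S" using assms(1) open_contains_ball by blast
  then show False using assms(2) uncountable_ball countable_subset by blast
qed

lemma continuous_eq_off_countable:
  fixes f g :: "complex \<Rightarrow> 'b::t2_space"
  assumes "open U" "countable K" "continuous_on U f" "continuous_on U g"
    and eq: "\<And>z. z \<in> U - K \<Longrightarrow> f z = g z" and "z \<in> U"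
  shows "f z = g z"
proof -
  have "U \<inter> (\<lambda>z. (f z, g z)) -` {(a, b). a \<noteq> b} = {}"
  proof (rule open_countable_empty)
    have "open {(a::'b, b). a \<noteq> b}"
      using open_diagonal_complement by (simp add: split_def)
    then show "open (U \<inter> (\<lambda>z. (f z, g z)) -` {(a, b). a \<noteq> b})"
      using assms by (intro continuous_open_preimage continuous_on_Pair) auto
    show "countable (U \<inter> (\<lambda>z. (f z, g z)) -` {(a, b). a \<noteq> b})"
      by (rule countable_subset[OF _ assms(2)]) (use eq in auto)
  qed
  then show ?thesis using \<open>z \<in> U\<close> by auto
qed

text \<open>Otherwise the set would be perfect in a locally compact space, hence of at least the cardinality
  of the continuum.\<close>

lemma countable_closedin_isolated_point:
  fixes S U :: "complex set"
  assumes U: "open U" and S: "closedin (top_of_set U) S" "countable S" "S \<noteq> {}"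
  obtains z r where "z \<in> S" "r > 0" "ball z r \<subseteq> U" "ball z r \<inter> S = {z}"
proof -
  have SU: "S \<subseteq> U" using S(1) closedin_imp_subset by blast
  have "\<not> (top_of_set U) derived_set_of S = S"
  proof
    assume "(top_of_set U) derived_set_of S = S"
    moreover have "locally_compact_space (top_of_set U)"
      by (rule locally_compact_space_open_subset)
        (use U in \<open>auto simp: locally_compact_space_euclidean\<close>)
    ultimately have "(UNIV :: real set) \<lesssim> S"
      using S(3) by (intro lepoll_perfect_set[of "top_of_set U"]) (auto simp: Hausdorff_space_subtopology)
    then show False using S(2) countable_lepoll uncountable_UNIV_real by blast
  qed
  moreover have "(top_of_set U) derived_set_of S \<subseteq> S"
    using S(1) by (simp add: closedin_contains_derived_set)
  ultimately obtain z where z: "z \<in> S" "z \<notin> (top_of_set U) derived_set_of S" by blast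
  then obtain T where T: "openin (top_of_set U) T" "z \<in> T" "\<And>y. y \<noteq> z \<Longrightarrow> y \<in> S \<Longrightarrow> y \<notin> T"
    using SU by (auto simp: derived_set_of_def)
  have "open T" using T(1) U openin_open_eq by blast
  then obtain r where r: "r > 0" "ball z r \<subseteq> T" using T(2) open_contains_ball by blast
  show thesis
  proof
    show "ball z r \<subseteq> U" using r(2) T(1) openin_imp_subset by blast
    show "ball z r \<inter> S = {z}" using z(1) r T(3) by auto
  qed (use z(1) r(1) in auto)
qed

text \<open>Let \<open>V\<close> be the largest open set to which \<open>g\<close> extends; local extensions glue because two of them agree
  off the countable set \<open>K\<close>, which has empty interior. The complement of \<open>V\<close> in \<open>U\<close> is countable and
  relatively closed, so if it were nonempty it would have an isolated point, and this point could be
  removed by Riemann's theorem on removable singularities.\<close>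

theorem holomorphic_extend_across_countable:
  fixes g :: "complex \<Rightarrow> complex"
  assumes U: "open U" and K: "closed K" "countable K" and g: "g holomorphic_on U - K"
    and bdd: "\<And>z. z \<in> U \<Longrightarrow> \<exists>r>0. \<exists>M. \<forall>w\<in>ball z r \<inter> U - K. cmod (g w) \<le> M"
  obtains G where "G holomorphic_on U" "\<And>w. w \<in> U - K \<Longrightarrow> G w = g w"
proof -
  define ext where "ext W h \<longleftrightarrow> open W \<and> W \<subseteq> U \<and> h holomorphic_on W \<and> (\<forall>w\<in>W - K. h w = g w)" for W h
  define V where "V = \<Union>{W. \<exists>h. ext W h}"
  have "\<exists>W h. z \<in> W \<and> ext W h" if "z \<in> V" for z using that by (auto simp: V_def)
  then obtain W H where WH: "\<And>z. z \<in> V \<Longrightarrow> z \<in> W z \<and> ext (W z) (H z)" by metis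
  define G where "G z = H z z" for z
  have WV: "W z \<subseteq> V" if "z \<in> V" for z using WH[OF that] by (auto simp: V_def)
  have GH: "G w = H z w" if "z \<in> V" "w \<in> W z" for z w
  proof -
    have w: "w \<in> V" using that WV by blast
    have e: "ext (W w) (H w)" "ext (W z) (H z)" "w \<in> W w" using WH w that by auto
    show ?thesis unfolding G_def
    proof (rule continuous_eq_off_countable[of "W w \<inter> W z" K "H w" "H z"])
      have "H w holomorphic_on W w \<inter> W z" "H z holomorphic_on W w \<inter> W z"
        using e(1,2) unfolding ext_def by (meson holomorphic_on_subset inf_le1 inf_le2)+
      then show "continuous_on (W w \<inter> W z) (H w)" "continuous_on (W w \<inter> W z) (H z)"
        by (simp_all add: holomorphic_on_imp_continuous_on)
    qed (use e that K(2) in \<open>auto simp: ext_def\<close>)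
  qed
  have V: "V = (\<Union>z\<in>V. W z)" using WH WV by blast
  have oW: "open (W z)" if "z \<in> V" for z using WH[OF that] by (simp add: ext_def)
  have "ext V G"
    unfolding ext_def
  proof (intro conjI ballI)
    show "open V" by (subst V) (use oW in auto)
    show "V \<subseteq> U" by (auto simp: V_def ext_def)
    have "G holomorphic_on W z" if z: "z \<in> V" for z
    proof -
      have "H z holomorphic_on W z" using WH[OF z] by (simp add: ext_def)
      then show ?thesis by (rule holomorphic_transform) (use GH z in auto)
    qed
    then have "G holomorphic_on (\<Union>z\<in>V. W z)" using oW by (rule holomorphic_on_UN_open)
    then show "G holomorphic_on V" using V by simp
    fix w assume "w \<in> V - K"
    then show "G w = g w" using WH[of w] by (auto simp: ext_def G_def)
  qed
  then have Vo: "open V" "V \<subseteq> U" "G holomorphic_on V" "\<And>w. w \<in> V - K \<Longrightarrow> G w = g w"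
    by (auto simp: ext_def)
  have UKV: "U - K \<subseteq> V"
  proof -
    have "ext (U - K) g" using U K(1) g by (auto simp: ext_def)
    then show ?thesis by (auto simp: V_def)
  qed
  have "U - V = {}"
  proof (rule ccontr)
    assume ne: "U - V \<noteq> {}"
    have "closedin (top_of_set U) (U - V)"
      using Vo(1) by (metis closedin_def Diff_Diff_Int Diff_subset openin_open_Int topspace_euclidean_subtopology)
    moreover have "countable (U - V)" using UKV K(2) by (auto intro: countable_subset)
    ultimately obtain z r where z: "z \<in> U - V" "r > 0" "ball z r \<subseteq> U" "ball z r \<inter> (U - V) = {z}"
      using countable_closedin_isolated_point[OF U _ _ ne] by blast
    have sub: "ball z r - {z} \<subseteq> V" using z by blast
    obtain s M where s: "s > 0" "\<And>w. w \<in> ball z s \<inter> U - K \<Longrightarrow> cmod (g w) \<le> M"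
      using bdd z(1) by blast
    define t where "t = min r s"
    have Gb: "cmod (G w) \<le> M" if w: "w \<in> ball z t - {z}" for w
    proof (rule ccontr)
      assume "\<not> cmod (G w) \<le> M"
      have "ball z t - {z} \<subseteq> V" using sub by (auto simp: t_def)
      then have cont: "continuous_on (ball z t - {z}) G"
        using Vo(3) holomorphic_on_subset holomorphic_on_imp_continuous_on by blast
      have "(ball z t - {z}) \<inter> G -` (- cball 0 M) = {}"
      proof (rule open_countable_empty)
        show "open ((ball z t - {z}) \<inter> G -` (- cball 0 M))"
          using cont by (intro continuous_open_preimage) auto
        show "countable ((ball z t - {z}) \<inter> G -` (- cball 0 M))"
        proof (rule countable_subset[OF _ K(2)], rule subsetI)
          fix v assume "v \<in> (ball z t - {z}) \<inter> G -` (- cball 0 M)"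
          then have v: "v \<in> ball z t" "v \<noteq> z" "G v \<notin> cball 0 M" by auto
          show "v \<in> K"
          proof (rule ccontr)
            assume "v \<notin> K"
            have "v \<in> V" using v sub by (auto simp: t_def)
            then have "cmod (g v) \<le> M" using s(2)[of v] v(1) \<open>v \<notin> K\<close> Vo(2) by (auto simp: t_def)
            then show False using v Vo(4)[of v] \<open>v \<in> V\<close> \<open>v \<notin> K\<close> by simp
          qed
        qed
      qed
      then show False using w \<open>\<not> cmod (G w) \<le> M\<close> by auto
    qed
    have "\<exists>h. h holomorphic_on ball z r \<and> (\<forall>w\<in>ball z r - {z}. h w = G w)"
    proof (subst holomorphic_on_extend_bounded[OF holomorphic_on_subset[OF Vo(3) sub]])
      show "\<exists>B. \<forall>\<^sub>F w in at z. cmod (G w) \<le> B"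
        unfolding eventually_at using Gb z(2) s(1)
        by (intro exI[of _ M] exI[of _ t]) (auto simp: t_def dist_commute)
    qed (use z(2) in simp)
    then obtain h where h: "h holomorphic_on ball z r" "\<And>w. w \<in> ball z r - {z} \<Longrightarrow> h w = G w" by blast
    have "z \<in> K" using z(1) UKV by blast
    have "h w = g w" if "w \<in> ball z r - K" for w
    proof -
      have "w \<in> ball z r - {z}" "w \<in> V - K" using that sub \<open>z \<in> K\<close> by blast+
      then show ?thesis using h(2) Vo(4) by metis
    qed
    then have "ext (ball z r) h" using h(1) z(3) by (auto simp: ext_def)
    then have "z \<in> V" using z(2) by (auto simp: V_def intro!: exI[of _ "ball z r"])
    then show False using z(1) by blast
  qed
  then have "U = V" using Vo(2) by blast
  then show thesis using that Vo by blast
qed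

text \<open>The second alternative is how Picard's theorem phrases a pole; the bound then comes from the
  order of vanishing of \<open>inverse \<circ> G\<close>. Since \<open>inverse 0 = 0\<close>, it has to be excluded first that zeros of
  \<open>G\<close> are hidden in the limit of \<open>inverse \<circ> G\<close>.\<close>

lemma nonessential_power_bound:
  fixes G :: "complex \<Rightarrow> complex"
  assumes hol: "G holomorphic_on ball a r - {a}" and r: "r > 0"
    and lim: "(G \<longlongrightarrow> l) (at a) \<or> ((inverse \<circ> G) \<longlongrightarrow> l) (at a)"
  obtains N \<delta> C where "\<delta> > 0" "\<And>z. z \<in> ball a \<delta> - {a} \<Longrightarrow> cmod ((z - a) ^ N * G z) \<le> C"
proof (cases "(G \<longlongrightarrow> l) (at a) \<or> l \<noteq> 0")
  case True
  have "(G \<longlongrightarrow> l) (at a) \<or> (G \<longlongrightarrow> inverse l) (at a)"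
  proof (cases "(G \<longlongrightarrow> l) (at a)")
    case False
    then have "((inverse \<circ> G) \<longlongrightarrow> l) (at a)" "l \<noteq> 0" using lim True by auto
    from tendsto_inverse[OF this] show ?thesis by (simp add: o_def)
  qed simp
  then obtain l' where "(G \<longlongrightarrow> l') (at a)" by blast
  then have "\<forall>\<^sub>F z in at a. dist (G z) l' < 1" by (rule tendstoD) simp
  then obtain \<delta> where \<delta>: "\<delta> > 0" "\<And>z. z \<noteq> a \<Longrightarrow> dist z a < \<delta> \<Longrightarrow> dist (G z) l' < 1"
    by (auto simp: eventually_at)
  show thesis
  proof (rule that[OF \<delta>(1), of 0 "cmod l' + 1"])
    fix z assume "z \<in> ball a \<delta> - {a}"
    then have "dist (G z) l' < 1" using \<delta>(2) by (auto simp: dist_commute)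
    then show "cmod ((z - a) ^ 0 * G z) \<le> cmod l' + 1"
      using norm_triangle_ineq2[of "G z" l'] by (simp add: dist_norm)
  qed
next
  case False
  then have inv: "((inverse \<circ> G) \<longlongrightarrow> 0) (at a)" using lim by auto
  then have "\<forall>\<^sub>F z in at a. dist ((inverse \<circ> G) z) 0 < 1" by (rule tendstoD) simp
  then obtain s where s: "s > 0" "\<And>z. z \<noteq> a \<Longrightarrow> dist z a < s \<Longrightarrow> cmod (inverse (G z)) < 1"
    by (auto simp: eventually_at)
  define t where "t = min r s"
  have t: "t > 0" "ball a t - {a} \<subseteq> ball a r - {a}" using r s by (auto simp: t_def)
  have hol': "G holomorphic_on ball a t - {a}" using hol t(2) by (rule holomorphic_on_subset)
  have small: "cmod (inverse (G z)) < 1" if "z \<in> ball a t - {a}" for z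
    using s(2)[of z] that by (auto simp: t_def dist_commute)
  have large: "G z \<in> - ball 0 1" if "z \<in> ball a t - {a}" "G z \<noteq> 0" for z
    using small[OF that(1)] that(2) by (simp add: norm_inverse norm_divide field_simps)
  have nz: "G z \<noteq> 0" if z: "z \<in> ball a t - {a}" for z
  proof
    assume "G z = 0"
    have "connected (G ` (ball a t - {a}))"
      by (intro connected_continuous_image holomorphic_on_imp_continuous_on hol' connected_punctured_ball) auto
    then have "{0} \<inter> G ` (ball a t - {a}) = {} \<or> - ball 0 1 \<inter> G ` (ball a t - {a}) = {}"
      by (rule connected_closedD) (use large in auto)
    then have zero: "G w = 0" if "w \<in> ball a t - {a}" for w
      using large[OF that] that z \<open>G z = 0\<close> by blast
    have "(G \<longlongrightarrow> 0) (at a)"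
      by (rule tendsto_eventually) (use zero t(1) in \<open>auto simp: eventually_at dist_commute intro!: exI[of _ t]\<close>)
    then show False using False by auto
  qed
  have holi: "(\<lambda>z. inverse (G z)) holomorphic_on ball a t - {a}"
    using hol' nz by (intro holomorphic_intros) auto
  have "\<exists>h. h holomorphic_on ball a t \<and> (\<forall>w\<in>ball a t - {a}. h w = inverse (G w))"
  proof (subst holomorphic_on_extend_bounded[OF holi])
    show "\<exists>B. \<forall>\<^sub>F w in at a. cmod (inverse (G w)) \<le> B"
      unfolding eventually_at using s by (intro exI[of _ 1] exI[of _ s]) (auto intro: less_imp_le)
  qed (use t(1) in auto)
  then obtain h where h: "h holomorphic_on ball a t" "\<And>w. w \<in> ball a t - {a} \<Longrightarrow> h w = inverse (G w)"
    by blast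
  have "isCont h a"
    using holomorphic_on_imp_continuous_on[OF h(1)] t(1) continuous_on_eq_continuous_at[OF open_ball]
    by (metis centre_in_ball)
  then have "(h \<longlongrightarrow> h a) (at a)" by (simp add: isCont_def)
  moreover have "(h \<longlongrightarrow> 0) (at a)"
    by (rule Lim_transform_within_open[OF inv, of "ball a t"]) (use t(1) h(2) in auto)
  ultimately have ha: "h a = 0" using tendsto_unique at_neq_bot by blast
  define b where "b = a + of_real (t / 2)"
  have b: "b \<in> ball a t - {a}" using t(1) by (auto simp: b_def dist_norm)
  have ne: "h b \<noteq> h a" using h(2)[OF b] nz[OF b] ha by simp
  have ab: "a \<in> ball a t" "b \<in> ball a t" using b t(1) by auto
  show thesis
  proof (rule holomorphic_lower_bound_difference[OF h(1) open_ball connected_ball ab ne])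
    fix k n \<delta>
    assume \<delta>: "0 < k" "0 < \<delta>" "ball a \<delta> \<subseteq> ball a t"
      "\<And>w. w \<in> ball a \<delta> \<Longrightarrow> k * cmod (w - a) ^ n \<le> cmod (h w - h a)"
    show thesis
    proof (rule that[OF \<delta>(2), of n "1 / k"])
      fix z assume z: "z \<in> ball a \<delta> - {a}"
      then have "z \<in> ball a t - {a}" using \<delta>(3) by blast
      then have "k * cmod (z - a) ^ n \<le> inverse (cmod (G z))" "cmod (G z) > 0"
        using \<delta>(4)[of z] z ha h(2) nz by (auto simp: norm_inverse)
      then show "cmod ((z - a) ^ n * G z) \<le> 1 / k"
        using \<delta>(1) by (simp add: norm_mult norm_power field_simps)
    qed
  qed
qed

lemma open_imp_fsigma:
  fixes S :: "'a::metric_space set"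
  assumes "open S"
  shows "fsigma S"
proof -
  have "fsigma_in euclidean S"
    using assms by (intro open_imp_fsigma_in metrizable_space_euclidean) simp
  then obtain C :: "nat \<Rightarrow> 'a set" where "\<And>n. closed (C n)" "\<Union>(range C) = S"
    by (auto simp: fsigma_in_ascending)
  then show ?thesis using fsigma.intros[of C] by simp
qed

section \<open>The resolvent\<close>

lemma bounded_bilinear_scaleC:
  "bounded_bilinear (scaleC :: complex \<Rightarrow> 'a::complex_normed_vector \<Rightarrow> 'a)"
proof
  show "\<exists>K. \<forall>a (b::'a). norm (a *\<^sub>C b) \<le> norm a * norm b * K"
    by (rule exI[of _ 1]) (simp add: norm_scaleC)
qed (simp_all add: scaleC_add_left scaleC_add_right scaleR_scaleC scaleC_scaleC mult.commute
      scaleR_conv_of_real)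

lemmas tendsto_scaleC = bounded_bilinear.tendsto[OF bounded_bilinear_scaleC]


lemma bounded_operators_iff:
  "A \<in> bounded_operators \<longleftrightarrow> (\<forall>c z. blinfun_apply A (c *\<^sub>C z) = c *\<^sub>C blinfun_apply A z)"
  by (auto simp: bounded_operators_def Vector_Spaces.linear_iff blinfun.add_right
      complex_vector.vector_space_axioms)

lemma bounded_operators_scaleC:
  "A \<in> bounded_operators \<Longrightarrow> blinfun_apply A (c *\<^sub>C z) = c *\<^sub>C blinfun_apply A z"
  by (simp add: bounded_operators_iff)

text \<open>The equation \<open>u - A u = z\<close> is solved by Banach's fixed point theorem applied to \<open>u \<mapsto> z + A u\<close>.\<close>

lemma neumann:
  fixes A :: "'a::complex_banach \<Rightarrow>\<^sub>L 'a"
  assumes A: "A \<in> bounded_operators" "norm A < 1"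
  obtains S where "S \<in> bounded_operators" "\<And>z. blinfun_apply S (z - blinfun_apply A z) = z"
    "\<And>z. blinfun_apply S z - blinfun_apply A (blinfun_apply S z) = z"
proof -
  have ex1: "\<exists>!u. z + blinfun_apply A u = u" for z
  proof (rule banach_fix_type[of "norm A"])
    show "\<forall>u v. dist (z + blinfun_apply A u) (z + blinfun_apply A v) \<le> norm A * dist u v"
      by (simp add: dist_norm norm_blinfun flip: blinfun.diff_right)
  qed (use A in auto)
  define s where "s z = (THE u. z + blinfun_apply A u = u)" for z
  have s: "z + blinfun_apply A (s z) = s z" for z
    unfolding s_def by (rule theI'[OF ex1])
  have s_eq: "s z = u" if "z + blinfun_apply A u = u" for z u
    using ex1[of z] s[of z] that by blast
  have "bounded_linear s"
  proof (rule bounded_linear_intro[where K = "1 / (1 - norm A)"])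
    show "s (u + v) = s u + s v" for u v
      by (rule s_eq) (use arg_cong2[OF s[of u] s[of v], of "(+)"] in \<open>simp add: blinfun.add_right algebra_simps\<close>)
    show "s (r *\<^sub>R u) = r *\<^sub>R s u" for r u
      by (rule s_eq) (use arg_cong[OF s[of u], of "scaleR r"] in \<open>simp add: blinfun.scaleR_right scaleR_add_right\<close>)
    fix z
    have "norm (s z) \<le> norm z + norm A * norm (s z)"
      using norm_triangle_ineq[of z "blinfun_apply A (s z)"] norm_blinfun[of A "s z"] s[of z] by simp
    then show "norm (s z) \<le> norm z * (1 / (1 - norm A))"
      using A(2) by (simp add: field_simps)
  qed
  then have bs: "blinfun_apply (Blinfun s) = s" by (simp add: bounded_linear_Blinfun_apply)
  show thesis
  proof (rule that[of "Blinfun s"])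
    have "s (c *\<^sub>C z) = c *\<^sub>C s z" for c z
      by (rule s_eq) (use arg_cong[OF s[of z], of "scaleC c"] in
          \<open>simp add: bounded_operators_scaleC[OF A(1)] scaleC_add_right\<close>)
    then show "Blinfun s \<in> bounded_operators" by (simp add: bounded_operators_iff bs)
    show "blinfun_apply (Blinfun s) (z - blinfun_apply A z) = z" for z
      unfolding bs by (rule s_eq) simp
    show "blinfun_apply (Blinfun s) z - blinfun_apply A (blinfun_apply (Blinfun s) z) = z" for z
      unfolding bs using s[of z] by (simp add: algebra_simps)
  qed
qed

definition resolvent :: "('a::complex_normed_vector \<Rightarrow>\<^sub>L 'a) \<Rightarrow> complex \<Rightarrow> 'a \<Rightarrow>\<^sub>L 'a" where
  "resolvent T l = (SOME S. S \<in> bounded_operators \<and>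
    S o\<^sub>L (l *\<^sub>C id_blinfun - T) = id_blinfun \<and> (l *\<^sub>C id_blinfun - T) o\<^sub>L S = id_blinfun)"

lemma blinfun_apply_shift:
  "blinfun_apply (l *\<^sub>C id_blinfun - T) z = l *\<^sub>C z - blinfun_apply T z"
  by (simp add: blinfun.diff_left scaleC_blinfun.rep_eq)

lemma resolvent:
  assumes "l \<notin> spectrum T"
  shows "resolvent T l \<in> bounded_operators"
    and "blinfun_apply (resolvent T l) (l *\<^sub>C z - blinfun_apply T z) = z"
    and "l *\<^sub>C blinfun_apply (resolvent T l) z - blinfun_apply T (blinfun_apply (resolvent T l) z) = z"
proof -
  have "\<exists>S. S \<in> bounded_operators \<and>
    S o\<^sub>L (l *\<^sub>C id_blinfun - T) = id_blinfun \<and> (l *\<^sub>C id_blinfun - T) o\<^sub>L S = id_blinfun"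
    using assms by (auto simp: spectrum_def)
  from someI_ex[OF this, folded resolvent_def]
  have R: "resolvent T l \<in> bounded_operators"
    "resolvent T l o\<^sub>L (l *\<^sub>C id_blinfun - T) = id_blinfun"
    "(l *\<^sub>C id_blinfun - T) o\<^sub>L resolvent T l = id_blinfun" by auto
  show "resolvent T l \<in> bounded_operators" by (rule R)
  show "blinfun_apply (resolvent T l) (l *\<^sub>C z - blinfun_apply T z) = z"
    using arg_cong[OF R(2), of "\<lambda>B. blinfun_apply B z"] by (simp add: blinfun_apply_shift)
  show "l *\<^sub>C blinfun_apply (resolvent T l) z - blinfun_apply T (blinfun_apply (resolvent T l) z) = z"
    using arg_cong[OF R(3), of "\<lambda>B. blinfun_apply B z"] by (simp add: blinfun_apply_shift)
qed

lemma not_in_spectrumI: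
  assumes "S \<in> bounded_operators"
    and "\<And>z. blinfun_apply S (l *\<^sub>C z - blinfun_apply T z) = z"
    and "\<And>z. l *\<^sub>C blinfun_apply S z - blinfun_apply T (blinfun_apply S z) = z"
  shows "l \<notin> spectrum T"
proof -
  have "S o\<^sub>L (l *\<^sub>C id_blinfun - T) = id_blinfun" "(l *\<^sub>C id_blinfun - T) o\<^sub>L S = id_blinfun"
    using assms(2,3) by (auto intro!: blinfun_eqI simp: blinfun_apply_shift)
  then show ?thesis using assms(1) by (auto simp: spectrum_def)
qed

text \<open>This is the factorisation \<open>m - T = (l - T) (1 - (l - m) R)\<close> with \<open>R\<close> the resolvent at \<open>l\<close>.\<close>

lemma not_in_spectrum_near:
  fixes T :: "'a::complex_banach \<Rightarrow>\<^sub>L 'a"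
  assumes T: "T \<in> bounded_operators" and l: "l \<notin> spectrum T"
    and m: "cmod (m - l) * norm (resolvent T l) < 1"
  shows "m \<notin> spectrum T"
proof -
  define R where "R = resolvent T l"
  note R = resolvent[OF l, folded R_def]
  have "(l - m) *\<^sub>C R \<in> bounded_operators"
    using R(1) by (auto simp: bounded_operators_iff scaleC_blinfun.rep_eq scaleC_scaleC mult.commute)
  moreover have "norm ((l - m) *\<^sub>C R) < 1"
    using m by (simp add: norm_scaleC R_def norm_minus_commute)
  ultimately obtain S where S: "S \<in> bounded_operators"
    "\<And>z. blinfun_apply S (z - (l - m) *\<^sub>C blinfun_apply R z) = z"
    "\<And>z. blinfun_apply S z - (l - m) *\<^sub>C blinfun_apply R (blinfun_apply S z) = z"
    using neumann[of "(l - m) *\<^sub>C R"] unfolding scaleC_blinfun.rep_eq by blast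
  show ?thesis
  proof (rule not_in_spectrumI[of "S o\<^sub>L R"])
    show "S o\<^sub>L R \<in> bounded_operators" using S(1) R(1) by (simp add: bounded_operators_iff)
    fix z
    have "m *\<^sub>C z - blinfun_apply T z = (l *\<^sub>C z - blinfun_apply T z) - (l - m) *\<^sub>C z"
      by (simp add: complex_vector.scale_left_diff_distrib)
    then have "blinfun_apply R (m *\<^sub>C z - blinfun_apply T z) = z - (l - m) *\<^sub>C blinfun_apply R z"
      by (simp only: blinfun.diff_right[of R "l *\<^sub>C z - blinfun_apply T z"] R(2) bounded_operators_scaleC[OF R(1)])
    then show "blinfun_apply (S o\<^sub>L R) (m *\<^sub>C z - blinfun_apply T z) = z" by (simp add: S(2))
    define u where "u = blinfun_apply S (blinfun_apply R z)"
    have "blinfun_apply R z = u - (l - m) *\<^sub>C blinfun_apply R u" using S(3) by (simp add: u_def)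
    then have "z = l *\<^sub>C (u - (l - m) *\<^sub>C blinfun_apply R u)
        - blinfun_apply T (u - (l - m) *\<^sub>C blinfun_apply R u)"
      using R(3)[of z] by simp
    also have "\<dots> = (l *\<^sub>C u - blinfun_apply T u)
        - (l - m) *\<^sub>C (l *\<^sub>C blinfun_apply R u - blinfun_apply T (blinfun_apply R u))"
      by (simp add: blinfun.diff_right bounded_operators_scaleC[OF T] complex_vector.scale_right_diff_distrib scaleC_scaleC
          mult.commute)
    also have "\<dots> = m *\<^sub>C u - blinfun_apply T u"
      by (simp only: R(3)) (simp add: complex_vector.scale_left_diff_distrib)
    finally show "m *\<^sub>C blinfun_apply (S o\<^sub>L R) z - blinfun_apply T (blinfun_apply (S o\<^sub>L R) z) = z"
      by (simp add: u_def)
  qed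
qed

lemma not_in_spectrum_large:
  fixes T :: "'a::complex_banach \<Rightarrow>\<^sub>L 'a"
  assumes T: "T \<in> bounded_operators" and m: "cmod m > norm T"
  shows "m \<notin> spectrum T"
proof -
  have m0: "m \<noteq> 0" using m by auto
  have "inverse m *\<^sub>C T \<in> bounded_operators"
    using T by (auto simp: bounded_operators_iff scaleC_blinfun.rep_eq scaleC_scaleC mult.commute)
  moreover have "norm (inverse m *\<^sub>C T) < 1"
    using m m0 by (simp add: norm_scaleC norm_inverse norm_divide field_simps)
  ultimately obtain S where S: "S \<in> bounded_operators"
    "\<And>z. blinfun_apply S (z - inverse m *\<^sub>C blinfun_apply T z) = z"
    "\<And>z. blinfun_apply S z - inverse m *\<^sub>C blinfun_apply T (blinfun_apply S z) = z"
    using neumann[of "inverse m *\<^sub>C T"] unfolding scaleC_blinfun.rep_eq by blast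
  show ?thesis
  proof (rule not_in_spectrumI[of "inverse m *\<^sub>C S"])
    show "inverse m *\<^sub>C S \<in> bounded_operators"
      using S(1) by (auto simp: bounded_operators_iff scaleC_blinfun.rep_eq scaleC_scaleC mult.commute)
    fix z
    have "blinfun_apply (inverse m *\<^sub>C S) (m *\<^sub>C z - blinfun_apply T z)
        = blinfun_apply S (inverse m *\<^sub>C (m *\<^sub>C z - blinfun_apply T z))"
      by (simp add: scaleC_blinfun.rep_eq bounded_operators_scaleC[OF S(1)])
    then show "blinfun_apply (inverse m *\<^sub>C S) (m *\<^sub>C z - blinfun_apply T z) = z"
      using m0 by (simp add: complex_vector.scale_right_diff_distrib scaleC_one S(2))
    show "m *\<^sub>C blinfun_apply (inverse m *\<^sub>C S) z - blinfun_apply T (blinfun_apply (inverse m *\<^sub>C S) z) = z"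
      using m0 by (simp add: scaleC_blinfun.rep_eq scaleC_one bounded_operators_scaleC[OF T] S(3))
  qed
qed

lemma resolvent_identity:
  assumes l: "l \<notin> spectrum T" and m: "m \<notin> spectrum T"
  shows "blinfun_apply (resolvent T l) z - blinfun_apply (resolvent T m) z
    = (m - l) *\<^sub>C blinfun_apply (resolvent T l) (blinfun_apply (resolvent T m) z)"
proof -
  define w where "w = blinfun_apply (resolvent T m) z"
  have "l *\<^sub>C w - blinfun_apply T w = z - (m - l) *\<^sub>C w"
    using resolvent(3)[OF m, of z] by (simp add: w_def complex_vector.scale_left_diff_distrib algebra_simps)
  then have "w = blinfun_apply (resolvent T l) (z - (m - l) *\<^sub>C w)"
    using resolvent(2)[OF l, of w] by simp
  also have "\<dots> = blinfun_apply (resolvent T l) z - (m - l) *\<^sub>C blinfun_apply (resolvent T l) w"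
    by (simp add: blinfun.diff_right bounded_operators_scaleC[OF resolvent(1)[OF l]])
  finally show ?thesis by (simp add: w_def algebra_simps)
qed

lemma resolvent_locally_bounded:
  fixes T :: "'a::complex_banach \<Rightarrow>\<^sub>L 'a"
  assumes T: "T \<in> bounded_operators" and l: "l \<notin> spectrum T"
  obtains r where "r > 0" "\<And>m. m \<in> ball l r \<Longrightarrow> m \<notin> spectrum T"
    "\<And>m z. m \<in> ball l r \<Longrightarrow>
      norm (blinfun_apply (resolvent T m) z) \<le> 2 * norm (resolvent T l) * norm z"
proof -
  define r where "r = 1 / (2 * (norm (resolvent T l) + 1))"
  have pos: "2 * (norm (resolvent T l) + 1) > 0" by (simp add: add_nonneg_pos)
  then have r: "r > 0" unfolding r_def by simp
  have half: "cmod (m - l) * norm (resolvent T l) \<le> 1 / 2" if "m \<in> ball l r" for m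
  proof -
    have "cmod (m - l) * norm (resolvent T l) \<le> r * (norm (resolvent T l) + 1)"
      using that r by (intro mult_mono) (auto simp: dist_norm norm_minus_commute)
    also have "\<dots> = 1 / 2" using pos by (simp add: r_def field_simps)
    finally show ?thesis .
  qed
  have ns: "m \<notin> spectrum T" if "m \<in> ball l r" for m
    using half[OF that] by (intro not_in_spectrum_near[OF T l]) simp
  show thesis
  proof (rule that[OF r ns])
    fix m z assume m: "m \<in> ball l r"
    define u where "u = blinfun_apply (resolvent T m) z"
    have "u = blinfun_apply (resolvent T l) z - (m - l) *\<^sub>C blinfun_apply (resolvent T l) u"
      using resolvent_identity[OF l ns[OF m], of z] by (simp add: u_def algebra_simps)
    then have "norm u \<le> norm (blinfun_apply (resolvent T l) z) + norm ((m - l) *\<^sub>C blinfun_apply (resolvent T l) u)"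
      by (metis norm_triangle_ineq4)
    also have "norm ((m - l) *\<^sub>C blinfun_apply (resolvent T l) u) \<le> cmod (m - l) * (norm (resolvent T l) * norm u)"
      by (simp add: norm_scaleC mult_left_mono norm_blinfun)
    also have "\<dots> \<le> (1 / 2) * norm u"
      using mult_right_mono[OF half[OF m], of "norm u"] by (simp add: mult.assoc)
    finally show "norm (blinfun_apply (resolvent T m) z) \<le> 2 * norm (resolvent T l) * norm z"
      using norm_blinfun[of "resolvent T l" z] by (simp add: u_def)
  qed
qed

lemma open_resolvent_set:
  fixes T :: "'a::complex_banach \<Rightarrow>\<^sub>L 'a"
  assumes "T \<in> bounded_operators"
  shows "open (- spectrum T)"
  unfolding open_contains_ball
  by (metis ComplD ComplI assms resolvent_locally_bounded subsetI)

lemma resolvent_tendsto: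
  fixes T :: "'a::complex_banach \<Rightarrow>\<^sub>L 'a"
  assumes T: "T \<in> bounded_operators" and l: "l \<notin> spectrum T"
  shows "((\<lambda>m. blinfun_apply (resolvent T m) z) \<longlongrightarrow> blinfun_apply (resolvent T l) z) (at l)"
proof -
  obtain r where r: "r > 0" "\<And>m. m \<in> ball l r \<Longrightarrow> m \<notin> spectrum T"
    "\<And>m z. m \<in> ball l r \<Longrightarrow>
      norm (blinfun_apply (resolvent T m) z) \<le> 2 * norm (resolvent T l) * norm z"
    using resolvent_locally_bounded[OF T l] by blast
  define K where "K = norm (resolvent T l) * (2 * norm (resolvent T l) * norm z)"
  have "((\<lambda>m. blinfun_apply (resolvent T m) z - blinfun_apply (resolvent T l) z) \<longlongrightarrow> 0) (at l)"
  proof (rule Lim_null_comparison)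
    show "\<forall>\<^sub>F m in at l. norm (blinfun_apply (resolvent T m) z - blinfun_apply (resolvent T l) z)
        \<le> cmod (m - l) * K"
      unfolding eventually_at
    proof (intro exI[of _ r] conjI r(1) ballI impI)
      fix m assume "m \<noteq> l \<and> dist m l < r"
      then have m: "m \<in> ball l r" by (simp add: dist_commute)
      have "norm (blinfun_apply (resolvent T m) z - blinfun_apply (resolvent T l) z)
          = norm (blinfun_apply (resolvent T l) z - blinfun_apply (resolvent T m) z)"
        by (rule norm_minus_commute)
      also have "\<dots> = cmod (m - l) * norm (blinfun_apply (resolvent T l) (blinfun_apply (resolvent T m) z))"
        by (simp add: resolvent_identity[OF l r(2)[OF m]] norm_scaleC)
      also have "\<dots> \<le> cmod (m - l) * K"
        unfolding K_def
        by (intro mult_left_mono order_trans[OF norm_blinfun] r(3)[OF m]) auto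
      finally show "norm (blinfun_apply (resolvent T m) z - blinfun_apply (resolvent T l) z)
        \<le> cmod (m - l) * K" .
    qed
    show "((\<lambda>m. cmod (m - l) * K) \<longlongrightarrow> 0) (at l)"
      by (rule tendsto_eq_intros | simp)+
  qed
  then show ?thesis by (simp add: LIM_zero_iff)
qed

lemma resolvent_has_field_derivative:
  fixes T :: "'a::complex_banach \<Rightarrow>\<^sub>L 'a"
  assumes T: "T \<in> bounded_operators" and l: "l \<notin> spectrum T" and \<phi>: "clinear_functional \<phi>"
  shows "((\<lambda>m. \<phi> (blinfun_apply (resolvent T m) z)) has_field_derivative
    - \<phi> (blinfun_apply (resolvent T l) (blinfun_apply (resolvent T l) z))) (at l)"
  unfolding has_field_derivative_iff
proof (rule Lim_transform_within_open[where s = "- spectrum T"])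
  note \<phi>D = clinear_functionalD[OF \<phi>]
  have "((\<lambda>m. \<phi> (blinfun_apply (resolvent T l) (blinfun_apply (resolvent T m) z))) \<longlongrightarrow>
      \<phi> (blinfun_apply (resolvent T l) (blinfun_apply (resolvent T l) z))) (at l)"
    by (intro bounded_linear.tendsto[OF \<phi>D(1)] bounded_linear.tendsto[OF blinfun.bounded_linear_right]
        resolvent_tendsto[OF T l])
  then show "((\<lambda>m. - \<phi> (blinfun_apply (resolvent T l) (blinfun_apply (resolvent T m) z))) \<longlongrightarrow>
      - \<phi> (blinfun_apply (resolvent T l) (blinfun_apply (resolvent T l) z))) (at l)"
    by (rule tendsto_minus)
  fix m assume m: "m \<in> - spectrum T" "m \<noteq> l"
  have "\<phi> (blinfun_apply (resolvent T l) z) - \<phi> (blinfun_apply (resolvent T m) z)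
      = (m - l) * \<phi> (blinfun_apply (resolvent T l) (blinfun_apply (resolvent T m) z))"
    using m by (simp add: resolvent_identity[OF l] \<phi>D(2) flip: \<phi>D(4))
  then have "\<phi> (blinfun_apply (resolvent T m) z) - \<phi> (blinfun_apply (resolvent T l) z)
      = - \<phi> (blinfun_apply (resolvent T l) (blinfun_apply (resolvent T m) z)) * (m - l)"
    by (simp add: algebra_simps)
  then show "- \<phi> (blinfun_apply (resolvent T l) (blinfun_apply (resolvent T m) z))
      = (\<phi> (blinfun_apply (resolvent T m) z) - \<phi> (blinfun_apply (resolvent T l) z)) / (m - l)"
    using m(2) by simp
qed (use l open_resolvent_set[OF T] in auto)

lemma resolvent_decay:
  assumes "m \<notin> spectrum T" "cmod m > norm T"
  shows "norm (blinfun_apply (resolvent T m) z) \<le> norm z / (cmod m - norm T)"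
proof -
  define u where "u = blinfun_apply (resolvent T m) z"
  have "m *\<^sub>C u = z + blinfun_apply T u"
    using resolvent(3)[OF assms(1), of z] by (simp add: u_def algebra_simps)
  then have "cmod m * norm u \<le> norm z + norm T * norm u"
    using norm_triangle_ineq[of z "blinfun_apply T u"] norm_blinfun[of T u]
    by (metis norm_scaleC add_left_mono order_trans)
  then show ?thesis using assms(2) by (simp add: u_def field_simps)
qed

section \<open>Singularities of the local resolvent\<close>

text \<open>Boundedness is only tested on the resolvent set, where the local resolvent has its canonical value.
  For countable spectrum these are the points that have no neighbourhood to which
  \<open>m \<mapsto> (m - T)\<^sup>-\<^sup>1 x\<close> extends holomorphically, that is, the local spectrum of \<open>T\<close> at \<open>x\<close>.\<close>

definition local_singularities ::
    "('a::complex_normed_vector \<Rightarrow>\<^sub>L 'a) \<Rightarrow> 'a \<Rightarrow> complex set" where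
  "local_singularities T x =
    {l. \<forall>r>0. \<forall>M. \<exists>m\<in>ball l r - spectrum T. M < norm (blinfun_apply (resolvent T m) x)}"

lemma not_local_singularity_iff:
  "l \<notin> local_singularities T x \<longleftrightarrow>
    (\<exists>r>0. \<exists>M. \<forall>m\<in>ball l r - spectrum T. norm (blinfun_apply (resolvent T m) x) \<le> M)"
  unfolding local_singularities_def
  by (simp only: mem_Collect_eq not_all not_imp bex_simps not_less ball_simps)

lemma closed_local_singularities: "closed (local_singularities T x)"
proof -
  have "\<exists>r>0. ball l r \<subseteq> - local_singularities T x" if "l \<in> - local_singularities T x" for l
  proof -
    have "l \<notin> local_singularities T x" using that by simp
    then obtain r M where r: "r > 0" "\<forall>m\<in>ball l r - spectrum T.
        norm (blinfun_apply (resolvent T m) x) \<le> M"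
      unfolding not_local_singularity_iff by blast
    have "k \<notin> local_singularities T x" if k: "k \<in> ball l r" for k
    proof -
      obtain s where s: "s > 0" "ball k s \<subseteq> ball l r" using k open_ball open_contains_ball by blast
      have "\<forall>m\<in>ball k s - spectrum T. norm (blinfun_apply (resolvent T m) x) \<le> M"
        using r(2) s(2) by blast
      then show ?thesis unfolding not_local_singularity_iff using s(1) by blast
    qed
    then show ?thesis using r(1) by blast
  qed
  then show ?thesis unfolding closed_def open_contains_ball by blast
qed

lemma local_singularities_subset_spectrum:
  fixes T :: "'a::complex_banach \<Rightarrow>\<^sub>L 'a"
  assumes "T \<in> bounded_operators"
  shows "local_singularities T x \<subseteq> spectrum T"
proof (rule ccontr)
  assume "\<not> local_singularities T x \<subseteq> spectrum T"
  then obtain l where l: "l \<in> local_singularities T x" "l \<notin> spectrum T" by blast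
  obtain r where r: "r > 0" "\<And>m. m \<in> ball l r \<Longrightarrow> m \<notin> spectrum T"
    "\<And>m z. m \<in> ball l r \<Longrightarrow>
      norm (blinfun_apply (resolvent T m) z) \<le> 2 * norm (resolvent T l) * norm z"
    using resolvent_locally_bounded[OF assms l(2)] by blast
  have "l \<notin> local_singularities T x"
    unfolding not_local_singularity_iff
  proof (intro exI conjI ballI)
    fix m assume "m \<in> ball l r - spectrum T"
    then show "norm (blinfun_apply (resolvent T m) x) \<le> 2 * norm (resolvent T l) * norm x"
      by (intro r(3)) simp
  qed (rule r(1))
  then show False using l(1) by blast
qed

lemma local_resolvent_holomorphic:
  fixes T :: "'a::complex_banach \<Rightarrow>\<^sub>L 'a"
  assumes "T \<in> bounded_operators" "clinear_functional \<phi>"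
  shows "(\<lambda>m. \<phi> (blinfun_apply (resolvent T m) x)) holomorphic_on - spectrum T"
  unfolding holomorphic_on_open[OF open_resolvent_set[OF assms(1)]]
  using resolvent_has_field_derivative[OF assms(1) _ assms(2)] by blast

lemma local_resolvent_extension:
  fixes T :: "'a::complex_banach \<Rightarrow>\<^sub>L 'a"
  assumes T: "T \<in> bounded_operators" "countable (spectrum T)" and \<phi>: "clinear_functional \<phi>"
    and U: "open U" "U \<inter> local_singularities T x = {}"
  obtains G where "G holomorphic_on U"
    "\<And>m. m \<in> U - spectrum T \<Longrightarrow> G m = \<phi> (blinfun_apply (resolvent T m) x)"
proof (rule holomorphic_extend_across_countable[of U "spectrum T" "\<lambda>m. \<phi> (blinfun_apply (resolvent T m) x)"])
  show "closed (spectrum T)" using open_resolvent_set[OF T(1)] by (simp add: closed_def)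
  show "(\<lambda>m. \<phi> (blinfun_apply (resolvent T m) x)) holomorphic_on U - spectrum T"
    by (rule holomorphic_on_subset[OF local_resolvent_holomorphic[OF T(1) \<phi>]]) auto
  fix z assume "z \<in> U"
  then have "z \<notin> local_singularities T x" using U(2) by blast
  then obtain r M where r: "r > 0" "\<And>m. m \<in> ball z r - spectrum T \<Longrightarrow>
      norm (blinfun_apply (resolvent T m) x) \<le> M"
    unfolding not_local_singularity_iff by blast
  obtain K where K: "K > 0" "\<And>z. cmod (\<phi> z) \<le> K * norm z" using clinear_functional_bound[OF \<phi>] by blast
  have "cmod (\<phi> (blinfun_apply (resolvent T m) x)) \<le> K * M" if "m \<in> ball z r \<inter> U - spectrum T" for m
  proof -
    have "m \<in> ball z r - spectrum T" using that by blast
    from mult_left_mono[OF r(2)[OF this], of K] show ?thesis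
      using K(1) order_trans[OF K(2)] by (metis less_imp_le)
  qed
  then show "\<exists>r>0. \<exists>M. \<forall>m\<in>ball z r \<inter> U - spectrum T. cmod (\<phi> (blinfun_apply (resolvent T m) x)) \<le> M"
    using r(1) by blast
qed (use U T that in auto)

text \<open>Otherwise \<open>\<phi> (R m x)\<close> extends to an entire function that tends to zero at infinity, so it vanishes
  for every \<open>\<phi>\<close>; then \<open>R m x = 0\<close> and \<open>x = 0\<close>.\<close>

lemma local_singularities_nonempty:
  fixes T :: "'a::complex_banach \<Rightarrow>\<^sub>L 'a"
  assumes T: "T \<in> bounded_operators" "countable (spectrum T)" and x: "x \<noteq> 0"
  shows "local_singularities T x \<noteq> {}"
proof
  assume none: "local_singularities T x = {}"
  define m where "m = complex_of_real (norm T + 1)"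
  have m: "m \<notin> spectrum T" by (rule not_in_spectrum_large[OF T(1)]) (simp add: m_def)
  have zero: "\<phi> (blinfun_apply (resolvent T m) x) = 0" if \<phi>: "clinear_functional \<phi>" for \<phi>
  proof -
    obtain G where G: "G holomorphic_on UNIV"
      "\<And>m. m \<in> UNIV - spectrum T \<Longrightarrow> G m = \<phi> (blinfun_apply (resolvent T m) x)"
      using local_resolvent_extension[OF T \<phi> open_UNIV] none by auto
    obtain K where K: "K > 0" "\<And>z. cmod (\<phi> z) \<le> K * norm z" using clinear_functional_bound[OF \<phi>] by blast
    have "(G \<longlongrightarrow> 0) at_infinity"
    proof (rule Lim_null_comparison)
      show "\<forall>\<^sub>F z in at_infinity. cmod (G z) \<le> K * (norm x / (cmod z - norm T))"
        unfolding eventually_at_infinity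
      proof (intro exI[of _ "norm T + 1"] allI impI)
        fix z :: complex assume "norm T + 1 \<le> cmod z"
        then have z: "cmod z > norm T" by simp
        then have zs: "z \<notin> spectrum T" by (rule not_in_spectrum_large[OF T(1)])
        then have "cmod (G z) \<le> K * norm (blinfun_apply (resolvent T z) x)" using G(2) K(2) by simp
        also have "\<dots> \<le> K * (norm x / (cmod z - norm T))"
          using K(1) by (intro mult_left_mono resolvent_decay zs z) simp
        finally show "cmod (G z) \<le> K * (norm x / (cmod z - norm T))" .
      qed
      have "filterlim (\<lambda>z::complex. cmod z - norm T) at_top at_infinity"
        using filterlim_tendsto_add_at_top[OF tendsto_const[of "- norm T"] filterlim_norm_at_top]
        by simp
      then have "filterlim (\<lambda>z::complex. cmod z - norm T) at_infinity at_infinity"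
        by (rule filterlim_at_top_imp_at_infinity)
      then have "((\<lambda>z::complex. norm x / (cmod z - norm T)) \<longlongrightarrow> 0) at_infinity"
        by (intro tendsto_divide_0[OF tendsto_const])
      then show "((\<lambda>z::complex. K * (norm x / (cmod z - norm T))) \<longlongrightarrow> 0) at_infinity"
        by (rule tendsto_mult_right_zero)
    qed
    then have "G m = 0" by (rule Liouville_weak_0[OF G(1)])
    then show ?thesis using G(2) m by simp
  qed
  have "norm (blinfun_apply (resolvent T m) x) \<le> 0"
    using norming_functional[of "blinfun_apply (resolvent T m) x"] zero by (metis norm_zero)
  then have "blinfun_apply (resolvent T m) x = 0" by simp
  then show False using resolvent(3)[OF m, of x] x by simp
qed

text \<open>A Cauchy estimate for vector-valued functions, obtained by testing the difference with a norming
  functional. It provides limits in norm at points of the spectrum without any integration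
  of vector-valued functions.\<close>

lemma scaled_local_resolvent_Lipschitz:
  fixes T :: "'a::complex_banach \<Rightarrow>\<^sub>L 'a"
  assumes T: "T \<in> bounded_operators" "countable (spectrum T)" and r: "r > 0"
    and bound: "\<And>m. m \<in> ball a r - spectrum T \<Longrightarrow>
      norm ((m - a) ^ N *\<^sub>C blinfun_apply (resolvent T m) x) \<le> C"
    and m: "m \<in> ball a (r / 2) - spectrum T" and n: "n \<in> ball a (r / 2) - spectrum T"
  shows "norm ((m - a) ^ N *\<^sub>C blinfun_apply (resolvent T m) x - (n - a) ^ N *\<^sub>C blinfun_apply (resolvent T n) x)
    \<le> 8 * C / r * cmod (m - n)"
proof -
  define F where "F m = (m - a) ^ N *\<^sub>C blinfun_apply (resolvent T m) x" for m
  obtain \<phi> where \<phi>: "clinear_functional \<phi>" "\<And>y. cmod (\<phi> y) \<le> 2 * norm y"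
    "norm (F m - F n) \<le> cmod (\<phi> (F m - F n))"
    using norming_functional by blast
  note \<phi>D = clinear_functionalD[OF \<phi>(1)]
  have cS: "closed (spectrum T)" using open_resolvent_set[OF T(1)] by (simp add: closed_def)
  have FC: "cmod (\<phi> (F k)) \<le> 2 * C" if "k \<in> ball a r - spectrum T" for k
    using bound[OF that] order_trans[OF \<phi>(2)[of "F k"]] by (simp add: F_def)
  have "(\<lambda>k. (k - a) ^ N * \<phi> (blinfun_apply (resolvent T k) x)) holomorphic_on ball a r - spectrum T"
    by (intro holomorphic_intros holomorphic_on_subset[OF local_resolvent_holomorphic[OF T(1) \<phi>(1)]]) auto
  then have hol: "(\<lambda>k. \<phi> (F k)) holomorphic_on ball a r - spectrum T"
    by (simp add: F_def \<phi>D(2))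
  obtain G where G: "G holomorphic_on ball a r" "\<And>k. k \<in> ball a r - spectrum T \<Longrightarrow> G k = \<phi> (F k)"
  proof (rule holomorphic_extend_across_countable[OF open_ball cS T(2) hol])
    show "\<exists>s>0. \<exists>M. \<forall>k\<in>ball z s \<inter> ball a r - spectrum T. cmod (\<phi> (F k)) \<le> M" for z
      using FC by (intro exI[of _ "1::real"] conjI exI[of _ "2 * C"]) auto
  qed (rule that)
  have GC: "cmod (G k) \<le> 2 * C" if k: "k \<in> ball a r" for k
  proof (rule ccontr)
    assume "\<not> cmod (G k) \<le> 2 * C"
    have "ball a r \<inter> G -` (- cball 0 (2 * C)) = {}"
    proof (rule open_countable_empty)
      show "open (ball a r \<inter> G -` (- cball 0 (2 * C)))"
        using holomorphic_on_imp_continuous_on[OF G(1)] by (intro continuous_open_preimage) auto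
      have "ball a r \<inter> G -` (- cball 0 (2 * C)) \<subseteq> spectrum T"
      proof (rule subsetI, rule ccontr)
        fix k assume "k \<in> ball a r \<inter> G -` (- cball 0 (2 * C))" "k \<notin> spectrum T"
        then show False using FC[of k] G(2)[of k] by simp
      qed
      then show "countable (ball a r \<inter> G -` (- cball 0 (2 * C)))" using T(2) countable_subset by blast
    qed
    then show False using k \<open>\<not> cmod (G k) \<le> 2 * C\<close> by auto
  qed
  have dG: "cmod (deriv G k) \<le> 8 * C / r" if k: "k \<in> ball a (r / 2)" for k
  proof -
    have sub: "cball k (r / 4) \<subseteq> ball a r"
    proof
      fix w assume "w \<in> cball k (r / 4)"
      then show "w \<in> ball a r" using k r dist_triangle[of a w k] by auto
    qed
    have "G holomorphic_on ball k (r / 4)" using G(1) sub ball_subset_cball holomorphic_on_subset by blast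
    moreover have "continuous_on (cball k (r / 4)) G"
      using G(1) sub holomorphic_on_subset holomorphic_on_imp_continuous_on by blast
    ultimately have "cmod ((deriv ^^ 1) G k) \<le> fact 1 * (2 * C) / (r / 4) ^ 1"
    proof (rule Cauchy_inequality)
      fix w assume "cmod (k - w) = r / 4"
      then have "w \<in> cball k (r / 4)" by (simp add: dist_norm)
      then show "cmod (G w) \<le> 2 * C" using sub GC by blast
    qed (use r in simp)
    then show ?thesis by (simp add: field_simps)
  qed
  have "cmod (G m - G n) \<le> 8 * C / r * cmod (m - n)"
  proof (rule field_differentiable_bound[OF convex_ball[of a "r / 2"]])
    fix k assume k: "k \<in> ball a (r / 2)"
    then have "k \<in> ball a r" using r by auto
    then show "(G has_field_derivative deriv G k) (at k within ball a (r / 2))"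
      using G(1) holomorphic_derivI[OF G(1) open_ball] has_field_derivative_at_within by blast
    show "cmod (deriv G k) \<le> 8 * C / r" by (rule dG[OF k])
  qed (use m n in auto)
  moreover have "m \<in> ball a r - spectrum T" "n \<in> ball a r - spectrum T" using m n r by auto
  ultimately show ?thesis using \<phi>(3) G(2) by (simp add: \<phi>D(4) F_def)
qed

text \<open>Induction on the exponent. For exponent \<open>Suc N\<close> the functions \<open>F m = (m - a) ^ Suc N *\<^sub>C R m x\<close>
  satisfy \<open>(m - T) (F m) = (m - a) ^ Suc N *\<^sub>C x\<close>, so their limit \<open>v\<close> at \<open>a\<close> satisfies \<open>(a - T) v = 0\<close>.
  Hence \<open>v = 0\<close>, and the Lipschitz estimate allows one factor \<open>m - a\<close> to be divided out.\<close>

lemma local_resolvent_no_power_bound: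
  fixes T :: "'a::complex_banach \<Rightarrow>\<^sub>L 'a"
  assumes T: "T \<in> bounded_operators" "countable (spectrum T)" "point_spectrum T = {}"
    and a: "a \<in> local_singularities T x" and r: "r > 0"
    and bound: "\<And>m. m \<in> ball a r - spectrum T \<Longrightarrow>
      norm ((m - a) ^ N *\<^sub>C blinfun_apply (resolvent T m) x) \<le> C"
  shows False
  using r bound
proof (induction N arbitrary: r C)
  case 0
  then have "\<forall>m\<in>ball a r - spectrum T. norm (blinfun_apply (resolvent T m) x) \<le> C"
    by (simp add: scaleC_one)
  then have "a \<notin> local_singularities T x"
    unfolding not_local_singularity_iff using 0(1) by blast
  then show False using a by blast
next
  case (Suc N)
  define F where "F m = (m - a) ^ Suc N *\<^sub>C blinfun_apply (resolvent T m) x" for m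
  define X where "X = ball a (r / 2) - spectrum T"
  define L where "L = 8 * C / r"
  have Lip: "norm (F m - F n) \<le> L * cmod (m - n)" if "m \<in> X" "n \<in> X" for m n
    unfolding F_def L_def
    using that Suc.prems by (intro scaled_local_resolvent_Lipschitz[OF T(1,2)]) (auto simp: X_def)
  have a_spec: "a \<in> spectrum T" using a local_singularities_subset_spectrum[OF T(1)] by blast
  have lim: "a islimpt X"
    unfolding islimpt_approachable
  proof (intro allI impI)
    fix e :: real assume e: "e > 0"
    have "ball a (min e (r / 2)) - spectrum T \<noteq> {}"
    proof
      assume "ball a (min e (r / 2)) - spectrum T = {}"
      then have "countable (ball a (min e (r / 2)))" using T(2) countable_subset by (metis Diff_eq_empty_iff)
      then show False using uncountable_ball[of "min e (r / 2)" a] e Suc.prems(1) by simp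
    qed
    then show "\<exists>x'\<in>X. x' \<noteq> a \<and> dist x' a < e" using a_spec by (auto simp: X_def dist_commute)
  qed
  have X_ne: "at a within X \<noteq> bot" using lim by (simp add: trivial_limit_within)
  have "uniformly_continuous_on X F"
  proof (rule lipschitz_on_uniformly_continuous)
    show "(\<bar>L\<bar>)-lipschitz_on X F"
    proof (rule lipschitz_onI)
      fix m n assume "m \<in> X" "n \<in> X"
      moreover have "L * cmod (m - n) \<le> \<bar>L\<bar> * cmod (m - n)" by (intro mult_right_mono) auto
      ultimately show "dist (F m) (F n) \<le> \<bar>L\<bar> * dist m n"
        using Lip order_trans unfolding dist_norm by blast
    qed simp
  qed
  then obtain v where v: "(F \<longlongrightarrow> v) (at a within X)"
    using uniformly_continuous_on_extension_at_closure[of X F a] lim islimpt_in_closure X_ne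
    by (metis Diff_empty Diff_insert0 X_def a_spec DiffD2)
  have id: "((\<lambda>m. m) \<longlongrightarrow> a) (at a within X)" by (rule tendsto_ident_at)
  have eq: "m *\<^sub>C F m - blinfun_apply T (F m) = (m - a) ^ Suc N *\<^sub>C x" if "m \<in> X" for m
  proof -
    have "m *\<^sub>C F m - blinfun_apply T (F m) = (m - a) ^ Suc N *\<^sub>C
        (m *\<^sub>C blinfun_apply (resolvent T m) x - blinfun_apply T (blinfun_apply (resolvent T m) x))"
      by (simp add: F_def bounded_operators_scaleC[OF T(1)] complex_vector.scale_right_diff_distrib mult.commute)
    then show ?thesis using resolvent(3)[of m T x] that by (simp add: X_def)
  qed
  have "((\<lambda>m. m *\<^sub>C F m - blinfun_apply T (F m)) \<longlongrightarrow> a *\<^sub>C v - blinfun_apply T v) (at a within X)"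
    by (intro tendsto_diff tendsto_scaleC id v bounded_linear.tendsto[OF blinfun.bounded_linear_right])
  moreover have "((\<lambda>m. m *\<^sub>C F m - blinfun_apply T (F m)) \<longlongrightarrow> 0) (at a within X)"
  proof (rule Lim_transform_eventually)
    have "((\<lambda>m. (m - a) ^ Suc N *\<^sub>C x) \<longlongrightarrow> (a - a) ^ Suc N *\<^sub>C x) (at a within X)"
      by (intro tendsto_scaleC tendsto_power tendsto_diff id tendsto_const)
    then show "((\<lambda>m. (m - a) ^ Suc N *\<^sub>C x) \<longlongrightarrow> 0) (at a within X)" by simp
    show "\<forall>\<^sub>F m in at a within X. (m - a) ^ Suc N *\<^sub>C x = m *\<^sub>C F m - blinfun_apply T (F m)"
      using eq by (auto simp: eventually_at_filter)
  qed
  ultimately have "a *\<^sub>C v - blinfun_apply T v = 0" using tendsto_unique[OF X_ne] by blast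
  then have "blinfun_apply (a *\<^sub>C id_blinfun - T) v = blinfun_apply (a *\<^sub>C id_blinfun - T) 0"
    by (simp add: blinfun_apply_shift)
  moreover have "inj (blinfun_apply (a *\<^sub>C id_blinfun - T))" using T(3) by (auto simp: point_spectrum_def)
  ultimately have "v = 0" by (rule injD[rotated])
  have "norm (F m) \<le> L * cmod (m - a)" if m: "m \<in> X" for m
  proof (rule tendsto_le[OF X_ne])
    show "((\<lambda>n. norm (F m - F n)) \<longlongrightarrow> norm (F m)) (at a within X)"
      using tendsto_norm[OF tendsto_diff[OF tendsto_const v]] \<open>v = 0\<close> by simp
    show "((\<lambda>n. L * cmod (m - n)) \<longlongrightarrow> L * cmod (m - a)) (at a within X)"
      by (intro tendsto_intros id)
    show "\<forall>\<^sub>F n in at a within X. norm (F m - F n) \<le> L * cmod (m - n)"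
      using Lip[OF m] by (auto simp: eventually_at_filter)
  qed
  then have "norm ((m - a) ^ N *\<^sub>C blinfun_apply (resolvent T m) x) \<le> L"
    if m: "m \<in> ball a (r / 2) - spectrum T" for m
  proof -
    have "cmod (m - a) > 0" using m a_spec by auto
    moreover have "cmod (m - a) * norm ((m - a) ^ N *\<^sub>C blinfun_apply (resolvent T m) x) \<le> L * cmod (m - a)"
      using \<open>\<And>m. m \<in> X \<Longrightarrow> norm (F m) \<le> L * cmod (m - a)\<close>[of m] m
      by (simp add: X_def F_def norm_scaleC norm_mult mult.assoc)
    ultimately show ?thesis by (simp add: mult.commute[of L])
  qed
  then show False using Suc.IH[of "r / 2" L] Suc.prems(1) by simp
qed

section \<open>Polynomial growth from weak polynomial growth\<close>

text \<open>A uniform boundedness principle in which the exponent and the radius may depend on the functional as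
  well. The dual is covered by countably many closed sets, one for each bound \<open>n\<close> that serves
  as exponent, as constant and, through \<open>1 / (n + 1)\<close>, as radius. One of them contains a ball, and a
  norming functional of \<open>(m - a) ^ n *\<^sub>C f m\<close> can be moved into this ball. Real functionals are used
  because they form a complete space of all bounded linear maps; they are complexified to apply the
  hypothesis.\<close>

lemma weak_power_bound_imp_power_bound:
  fixes f :: "complex \<Rightarrow> 'a::complex_normed_vector"
  assumes weak: "\<And>\<phi>. clinear_functional \<phi> \<Longrightarrow>
    \<exists>N \<delta> C. \<delta> > 0 \<and> (\<forall>m\<in>S \<inter> ball a \<delta>. cmod ((m - a) ^ N * \<phi> (f m)) \<le> C)"
  obtains N \<delta> C where "\<delta> > 0" "\<And>m. m \<in> S \<inter> ball a \<delta> \<Longrightarrow> norm ((m - a) ^ N *\<^sub>C f m) \<le> C"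
proof -
  define F where "F n m = (m - a) ^ n *\<^sub>C f m" for n m
  define B where "B n = S \<inter> ball a (1 / (real n + 1))" for n
  define A where "A n = {\<psi>::'a \<Rightarrow>\<^sub>L real. \<forall>m\<in>B n. \<bar>blinfun_apply \<psi> (F n m)\<bar> \<le> real n}" for n
  have "\<Union>(range A) = UNIV"
  proof (intro equalityI subset_UNIV subsetI)
    fix \<psi> :: "'a \<Rightarrow>\<^sub>L real"
    define \<phi> where "\<phi> z = complex_of_real (blinfun_apply \<psi> z) - \<i> * complex_of_real (blinfun_apply \<psi> (\<i> *\<^sub>C z))" for z
    have \<phi>: "clinear_functional \<phi>"
      unfolding \<phi>_def by (rule clinear_functional_complexify[OF blinfun.bounded_linear_right])
    have Re: "\<bar>blinfun_apply \<psi> z\<bar> \<le> cmod (\<phi> z)" for z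
      using abs_Re_le_cmod[of "\<phi> z"] by (simp add: \<phi>_def)
    obtain N \<delta> C where \<delta>: "\<delta> > 0" "\<And>m. m \<in> S \<inter> ball a \<delta> \<Longrightarrow> cmod ((m - a) ^ N * \<phi> (f m)) \<le> C"
      using weak[OF \<phi>] by blast
    obtain n :: nat where n: "real n > max (max (real N) C) (1 / \<delta>)" using reals_Archimedean2 by blast
    have "1 / (real n + 1) \<le> \<delta>" using n \<delta>(1) by (simp add: field_simps)
    moreover have "1 / (real n + 1) \<le> 1" by simp
    ultimately have "\<bar>blinfun_apply \<psi> (F n m)\<bar> \<le> real n" if m: "m \<in> B n" for m
    proof -
      have ma: "cmod (m - a) < 1 / (real n + 1)" using m by (simp add: B_def dist_norm norm_minus_commute)
      have m': "m \<in> S \<inter> ball a \<delta>" using m \<open>1 / (real n + 1) \<le> \<delta>\<close> by (auto simp: B_def)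
      have m1: "cmod (m - a) \<le> 1" using ma \<open>1 / (real n + 1) \<le> 1\<close> by linarith
      have "\<bar>blinfun_apply \<psi> (F n m)\<bar> \<le> cmod (m - a) ^ n * cmod (\<phi> (f m))"
        using Re[of "F n m"] by (simp add: F_def clinear_functionalD(2)[OF \<phi>] norm_mult norm_power)
      also have "\<dots> \<le> cmod (m - a) ^ N * cmod (\<phi> (f m))"
        using n m1 by (intro mult_right_mono power_decreasing) auto
      also have "\<dots> \<le> C" using \<delta>(2)[OF m'] by (simp add: norm_mult norm_power)
      finally show ?thesis using n by simp
    qed
    then show "\<psi> \<in> \<Union>(range A)" by (auto simp: A_def)
  qed
  have closedA: "closed (A n)" for n
  proof -
    have "A n = (\<Inter>m\<in>B n. {\<psi>. \<bar>blinfun_apply \<psi> (F n m)\<bar> \<le> real n})" by (auto simp: A_def)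
    moreover have "closed {\<psi>::'a \<Rightarrow>\<^sub>L real. \<bar>blinfun_apply \<psi> (F n m)\<bar> \<le> real n}" for m
      by (intro closed_Collect_le continuous_intros)
    ultimately show ?thesis by auto
  qed
  have "\<exists>n. interior (A n) \<noteq> {}"
  proof (rule ccontr)
    assume "\<not> (\<exists>n. interior (A n) \<noteq> {})"
    then have "euclidean interior_of (\<Union>(range A)) = {}"
      using closedA by (intro Baire_category_alt) (auto simp: completely_metrizable_space_euclidean)
    then show False using \<open>\<Union>(range A) = UNIV\<close> by simp
  qed
  then obtain n \<psi>0 e where e: "e > 0" "ball \<psi>0 e \<subseteq> A n" by (metis ex_in_conv mem_interior)
  have bound: "norm (F n m) \<le> 4 * real n / e" if m: "m \<in> B n" for m
  proof -
    obtain l :: "'a \<Rightarrow> real" where l: "bounded_linear l" "\<And>x. \<bar>l x\<bar> \<le> norm x" "l (F n m) = norm (F n m)"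
      using norming_functional_real by blast
    \<comment> \<open>The ball is not centred at zero: compare its centre with a point displaced in the direction of \<open>l\<close>.\<close>
    define L where "L = Blinfun l"
    have L: "blinfun_apply L = l" using l(1) by (simp add: L_def bounded_linear_Blinfun_apply)
    have "norm L \<le> 1" using l(2) by (intro norm_blinfun_bound) (auto simp: L)
    then have "\<psi>0 + (e / 2) *\<^sub>R L \<in> ball \<psi>0 e" "\<psi>0 \<in> ball \<psi>0 e"
      using e(1) mult_left_mono[of "norm L" 1 "e/2"] by (auto simp: dist_norm)
    then have "\<psi>0 + (e / 2) *\<^sub>R L \<in> A n" "\<psi>0 \<in> A n" using e(2) by auto
    then have "\<bar>blinfun_apply \<psi>0 (F n m) + (e / 2) * norm (F n m)\<bar> \<le> n" "\<bar>blinfun_apply \<psi>0 (F n m)\<bar> \<le> n"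
      using m by (auto simp: A_def blinfun.add_left blinfun.scaleR_left L l(3))
    then have "e * norm (F n m) \<le> 4 * real n" by linarith
    then show ?thesis using e(1) by (simp add: field_simps)
  qed
  show thesis
    by (rule that[of "1 / (real n + 1)" n]) (use bound in \<open>auto simp: B_def F_def\<close>)
qed

section \<open>Rank-one perturbations with infinitely many simple eigenvalues\<close>

text \<open>The points found here are the eigenvalues of \<open>z \<mapsto> T z + \<phi> z *\<^sub>C x\<close> in the resolvent set of \<open>T\<close>, and
  the last condition says that they are simple zeros of \<open>\<phi> (R m x) - 1\<close>.\<close>

lemma simple_rank_one_eigenvalues:
  fixes T :: "'a::complex_banach \<Rightarrow>\<^sub>L 'a"
  assumes T: "T \<in> bounded_operators" "countable (spectrum T)" "point_spectrum T = {}"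
    and x: "x \<noteq> 0" and \<epsilon>: "\<epsilon> > 0"
  obtains \<phi> where "clinear_functional \<phi>" "\<And>z. cmod (\<phi> z) \<le> \<epsilon> * norm z"
    "infinite {m. m \<notin> spectrum T \<and> \<phi> (blinfun_apply (resolvent T m) x) = 1 \<and>
      \<phi> (blinfun_apply (resolvent T m) (blinfun_apply (resolvent T m) x)) \<noteq> 0}"
proof -
  have sub: "local_singularities T x \<subseteq> spectrum T"
    by (rule local_singularities_subset_spectrum[OF T(1)])
  have "closedin (top_of_set UNIV) (local_singularities T x)"
    using closed_local_singularities by simp
  then obtain a r where a: "a \<in> local_singularities T x" "r > 0"
    "ball a r \<inter> local_singularities T x = {a}"
    by (rule countable_closedin_isolated_point[OF open_UNIV _ countable_subset[OF sub T(2)]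
          local_singularities_nonempty[OF T(1,2) x]])
  have a_spec: "a \<in> spectrum T" using a(1) sub by blast
  define D where "D = ball a r - {a}"
  have D: "open D" "connected D" "D \<inter> local_singularities T x = {}"
    using a(3) by (auto simp: D_def connected_punctured_ball)
  have "\<exists>\<phi> G. clinear_functional \<phi> \<and> G holomorphic_on D \<and>
      (\<forall>m\<in>D - spectrum T. G m = \<phi> (blinfun_apply (resolvent T m) x)) \<and>
      (\<forall>l. \<not> (G \<longlongrightarrow> l) (at a) \<and> \<not> ((inverse \<circ> G) \<longlongrightarrow> l) (at a))"
  proof (rule ccontr)
    assume no: "\<not> ?thesis"
    have weak: "\<exists>N \<delta> C. \<delta> > 0 \<and> (\<forall>m\<in>- spectrum T \<inter> ball a \<delta>.
        cmod ((m - a) ^ N * \<phi> (blinfun_apply (resolvent T m) x)) \<le> C)"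
      if \<phi>: "clinear_functional \<phi>" for \<phi>
    proof -
      obtain G where G: "G holomorphic_on D"
        "\<And>m. m \<in> D - spectrum T \<Longrightarrow> G m = \<phi> (blinfun_apply (resolvent T m) x)"
        using local_resolvent_extension[OF T(1,2) \<phi> D(1,3)] by blast
      obtain l where l: "(G \<longlongrightarrow> l) (at a) \<or> ((inverse \<circ> G) \<longlongrightarrow> l) (at a)"
        using no G \<phi> by blast
      show ?thesis
      proof (rule nonessential_power_bound[OF G(1)[unfolded D_def] a(2) l])
        fix N \<delta> C
        assume \<delta>: "\<delta> > 0" "\<And>z. z \<in> ball a \<delta> - {a} \<Longrightarrow> cmod ((z - a) ^ N * G z) \<le> C"
        have "cmod ((m - a) ^ N * \<phi> (blinfun_apply (resolvent T m) x)) \<le> C"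
          if m: "m \<in> - spectrum T \<inter> ball a (min r \<delta>)" for m
        proof -
          have "m \<noteq> a" using m a_spec by blast
          then have "m \<in> D - spectrum T" "m \<in> ball a \<delta> - {a}" using m by (auto simp: D_def)
          then show ?thesis using \<delta>(2)[of m] G(2)[of m] by simp
        qed
        then show ?thesis
          using \<delta>(1) a(2) by (intro exI[of _ N] exI[of _ "min r \<delta>"] exI[of _ C]) auto
      qed
    qed
    show False
    proof (rule weak_power_bound_imp_power_bound[OF weak])
      fix N \<delta> C
      assume \<delta>: "\<delta> > 0" "\<And>m. m \<in> - spectrum T \<inter> ball a \<delta> \<Longrightarrow>
        norm ((m - a) ^ N *\<^sub>C blinfun_apply (resolvent T m) x) \<le> C"
      show False
        by (rule local_resolvent_no_power_bound[OF T a(1) \<delta>(1), of N C]) (use \<delta>(2) in auto)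
    qed
  qed
  then obtain \<phi> G where \<phi>: "clinear_functional \<phi>" and G: "G holomorphic_on D"
    "\<And>m. m \<in> D - spectrum T \<Longrightarrow> G m = \<phi> (blinfun_apply (resolvent T m) x)"
    and nolim: "\<And>l. \<not> (G \<longlongrightarrow> l) (at a)" "\<And>l. \<not> ((inverse \<circ> G) \<longlongrightarrow> l) (at a)"
    by blast
  obtain p where p: "\<And>w. w \<noteq> p \<Longrightarrow> infinite {z. z \<in> ball a r - {a} \<and> G z = w}"
    using great_Picard_infinite[OF open_ball _ G(1)[unfolded D_def] nolim] a(2) by auto
  \<comment> \<open>Critical points could be uncountable only for constant \<open>G\<close>, which would have a limit at \<open>a\<close>.\<close>
  have critical: "countable {z \<in> D. deriv G z = 0}"
  proof (rule ccontr)
    assume unc: "uncountable {z \<in> D. deriv G z = 0}"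
    have "deriv G holomorphic_on D" using G(1) D(1) by (rule holomorphic_deriv)
    then have "deriv G constant_on D"
      using holomorphic_countable_zeros[of "deriv G" D] D(1,2) unc open_imp_fsigma by blast
    moreover obtain z where "z \<in> D" "deriv G z = 0"
      using unc by (metis (mono_tags, lifting) countable_empty empty_Collect_eq)
    ultimately have zero: "deriv G z = 0" if "z \<in> D" for z using that by (metis constant_on_def)
    obtain c where c: "\<And>z. z \<in> D \<Longrightarrow> G z = c"
    proof (rule DERIV_zero_connected_constant[OF D(2,1) finite.emptyI])
      show "continuous_on D G" using G(1) by (rule holomorphic_on_imp_continuous_on)
      show "\<forall>z\<in>D - {}. (G has_field_derivative 0) (at z)"
        using holomorphic_derivI[OF G(1) D(1)] zero by (metis Diff_empty)
    qed (rule that)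
    have "(G \<longlongrightarrow> c) (at a)"
      by (rule tendsto_eventually)
        (use c a(2) in \<open>auto simp: eventually_at D_def dist_commute intro!: exI[of _ r]\<close>)
    then show False using nolim(1) by blast
  qed
  obtain K where K: "K > 0" "\<And>z. cmod (\<phi> z) \<le> K * norm z"
    using clinear_functional_bound[OF \<phi>] by blast
  \<comment> \<open>Avoiding countably many values excludes Picard's exceptional value, solutions in the spectrum, and
    multiple solutions at once. On the half-plane \<open>Re w > K / \<epsilon>\<close> the functional \<open>\<phi> / w\<close> is small.\<close>
  define bad where "bad = insert p (G ` spectrum T \<union> G ` {z \<in> D. deriv G z = 0})"
  have "countable bad" using T(2) critical by (simp add: bad_def)
  then have "\<not> {w. Re w > K / \<epsilon>} \<subseteq> bad" using uncountable_halfspace_Re_gt countable_subset by blast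
  then obtain w where w: "Re w > K / \<epsilon>" "w \<notin> bad" by blast
  have wK: "K / \<epsilon> < cmod w" using w(1) complex_Re_le_cmod[of w] by linarith
  have w0: "cmod w > 0" using wK K(1) \<epsilon> by (smt (verit) divide_pos_pos)
  show thesis
  proof
    show "clinear_functional (\<lambda>z. \<phi> z / w)"
      unfolding clinear_functional_def
      by (auto simp: clinear_functionalD(2)[OF \<phi>] intro: bounded_linear_compose[OF bounded_linear_divide clinear_functionalD(1)[OF \<phi>]])
    show "cmod (\<phi> z / w) \<le> \<epsilon> * norm z" for z
    proof -
      have "cmod (\<phi> z) \<le> K * norm z" by (rule K(2))
      also have "\<dots> \<le> (\<epsilon> * cmod w) * norm z"
        using wK \<epsilon> by (intro mult_right_mono) (auto simp: field_simps)
      finally show ?thesis using w0 by (simp add: norm_divide field_simps)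
    qed
    have "w \<noteq> p" using w(2) by (simp add: bad_def)
    then have "infinite {z \<in> D. G z = w}" using p by (simp add: D_def)
    moreover have "{z \<in> D. G z = w} \<subseteq> {m. m \<notin> spectrum T \<and> \<phi> (blinfun_apply (resolvent T m) x) / w = 1 \<and>
      \<phi> (blinfun_apply (resolvent T m) (blinfun_apply (resolvent T m) x)) / w \<noteq> 0}"
    proof clarify
      fix z assume z: "z \<in> D" "w = G z"
      have zs: "z \<notin> spectrum T" "deriv G z \<noteq> 0" using w(2) z by (auto simp: bad_def)
      have "((\<lambda>m. \<phi> (blinfun_apply (resolvent T m) x)) has_field_derivative
          - \<phi> (blinfun_apply (resolvent T z) (blinfun_apply (resolvent T z) x))) (at z)"
        by (rule resolvent_has_field_derivative[OF T(1) zs(1) \<phi>])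
      then have "(G has_field_derivative
          - \<phi> (blinfun_apply (resolvent T z) (blinfun_apply (resolvent T z) x))) (at z)"
      proof (rule has_field_derivative_transform_within_open[of _ _ _ "D - spectrum T"])
        show "open (D - spectrum T)" using D(1) open_resolvent_set[OF T(1)] by (simp add: Diff_eq open_Int)
      qed (use z zs G(2) in auto)
      then have "deriv G z = - \<phi> (blinfun_apply (resolvent T z) (blinfun_apply (resolvent T z) x))"
        by (rule DERIV_imp_deriv)
      then show "z \<notin> spectrum T \<and> \<phi> (blinfun_apply (resolvent T z) x) / G z = 1 \<and>
          \<phi> (blinfun_apply (resolvent T z) (blinfun_apply (resolvent T z) x)) / G z \<noteq> 0"
        using zs z w0 G(2)[of z] by auto
    qed
    ultimately show "infinite {m. m \<notin> spectrum T \<and> \<phi> (blinfun_apply (resolvent T m) x) / w = 1 \<and>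
      \<phi> (blinfun_apply (resolvent T m) (blinfun_apply (resolvent T m) x)) / w \<noteq> 0}"
      using infinite_super by blast
  qed
qed

section \<open>Halfspaces spanned by biorthogonal systems\<close>

lemma subspace_kernel:
  assumes "clinear_functional \<phi>"
  shows "complex_vector.subspace {z. \<phi> z = 0}"
  by (rule complex_vector.subspaceI) (auto simp: clinear_functionalD[OF assms])

text \<open>A sequence with a biorthogonal family of functionals is linearly independent.\<close>

lemma biorthogonal_not_in_finite_span:
  fixes v :: "nat \<Rightarrow> 'a::complex_normed_vector"
  assumes \<psi>: "\<And>n. clinear_functional (\<psi> n)" "\<And>n. \<psi> n (v n) \<noteq> 0" "\<And>m n. m \<noteq> n \<Longrightarrow> \<psi> n (v m) = 0"
    and B: "finite B"
  shows "\<not> range v \<subseteq> complex_vector.span B"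
proof
  assume span: "range v \<subseteq> complex_vector.span B"
  have "inj v"
  proof (rule injI, rule ccontr)
    fix m n assume "v m = v n" "m \<noteq> n"
    then show False using \<psi>(2)[of n] \<psi>(3)[of m n] by simp
  qed
  have "complex_vector.independent (range v)"
  proof
    assume "complex_vector.dependent (range v)"
    then obtain n where n: "v n \<in> complex_vector.span (range v - {v n})"
      unfolding complex_vector.dependent_def by blast
    have "range v - {v n} \<subseteq> {z. \<psi> n z = 0}"
    proof
      fix z assume "z \<in> range v - {v n}"
      then obtain m where "z = v m" "m \<noteq> n" by auto
      then show "z \<in> {z. \<psi> n z = 0}" using \<psi>(3)[of m n] by simp
    qed
    then have "complex_vector.span (range v - {v n}) \<subseteq> {z. \<psi> n z = 0}"
      using subspace_kernel[OF \<psi>(1)] by (rule complex_vector.span_minimal)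
    then show False using n \<psi>(2) by blast
  qed
  then have "finite (range v)" using complex_vector.independent_span_bound[OF B] span by blast
  then show False using \<open>inj v\<close> finite_imageD by blast
qed

lemma complex_subspace_closure:
  fixes V :: "'a::complex_normed_vector set"
  assumes "complex_vector.subspace V"
  shows "complex_vector.subspace (closure V)"
proof (rule complex_vector.subspaceI)
  show "0 \<in> closure V"
    using complex_vector.subspace_0[OF assms] closure_subset by blast
  show "u + v \<in> closure V" if uv: "u \<in> closure V" "v \<in> closure V" for u v
  proof -
    obtain f g where f: "\<And>n::nat. f n \<in> V" "f \<longlonglongrightarrow> u" and g: "\<And>n::nat. g n \<in> V" "g \<longlonglongrightarrow> v"
      using uv unfolding closure_sequential by blast
    have "f n + g n \<in> V" for n using complex_vector.subspace_add[OF assms f(1) g(1)] .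
    then show ?thesis unfolding closure_sequential
      using tendsto_add[OF f(2) g(2)] by (intro exI[of _ "\<lambda>n. f n + g n"]) simp
  qed
  have "(\<lambda>z. c *\<^sub>C z) ` closure V \<subseteq> closure V" for c
  proof (rule image_closure_subset)
    show "continuous_on (closure V) (\<lambda>z. c *\<^sub>C z)"
      by (rule linear_continuous_on[OF bounded_linear_scaleC])
    show "(\<lambda>z. c *\<^sub>C z) ` V \<subseteq> closure V"
      using complex_vector.subspace_scale[OF assms] closure_subset by blast
  qed simp
  then show "c *\<^sub>C z \<in> closure V" if "z \<in> closure V" for c z using that by blast
qed

lemma coset_eq_iff:
  assumes Y: "complex_vector.subspace Y"
  shows "coset Y u = coset Y v \<longleftrightarrow> u - v \<in> Y"
proof
  assume "coset Y u = coset Y v"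
  moreover have "u \<in> coset Y u" using complex_vector.subspace_0[OF Y] by (auto simp: coset_def intro: image_eqI[of _ _ 0])
  ultimately obtain y where "u = v + y" "y \<in> Y" by (auto simp: coset_def)
  then show "u - v \<in> Y" by simp
next
  assume uv: "u - v \<in> Y"
  have sub: "coset Y u \<subseteq> coset Y v" if "u - v \<in> Y" for u v
  proof
    fix z assume "z \<in> coset Y u"
    then obtain y where y: "z = u + y" "y \<in> Y" by (auto simp: coset_def)
    have "z = v + ((u - v) + y)" "(u - v) + y \<in> Y"
      using y that complex_vector.subspace_add[OF Y] by auto
    then show "z \<in> coset Y v" unfolding coset_def by blast
  qed
  have "v - u \<in> Y" using complex_vector.subspace_neg[OF Y uv] by simp
  then show "coset Y u = coset Y v" using sub uv by blast
qed

text \<open>For finite \<open>B\<close> this turns finite dimension of the quotient into a statement about vectors: the space is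
  then the sum of a finite-dimensional span and \<open>Y\<close>.\<close>

lemma quotient_span_representative:
  assumes Y: "complex_vector.subspace Y" and A: "A \<in> quotient_span Y (coset Y ` B)"
  shows "\<exists>u\<in>complex_vector.span B. A = coset Y u"
  using A
proof induction
  case zero
  show ?case using complex_vector.span_zero by blast
next
  case (base A)
  then show ?case using complex_vector.span_base by blast
next
  case (add u v)
  then obtain b c where b: "b \<in> complex_vector.span B" "u - b \<in> Y"
    and c: "c \<in> complex_vector.span B" "v - c \<in> Y"
    by (auto simp: coset_eq_iff[OF Y])
  have "(u + v) - (b + c) \<in> Y"
    using complex_vector.subspace_add[OF Y b(2) c(2)] by (simp add: algebra_simps)
  then show ?case using complex_vector.span_add[OF b(1) c(1)] coset_eq_iff[OF Y] by blast
next
  case (scale u c)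
  then obtain b where b: "b \<in> complex_vector.span B" "u - b \<in> Y" by (auto simp: coset_eq_iff[OF Y])
  have "c *\<^sub>C u - c *\<^sub>C b \<in> Y"
    using complex_vector.subspace_scale[OF Y b(2), of c]
    by (simp add: complex_vector.scale_right_diff_distrib)
  then show ?case using complex_vector.span_scale[OF b(1)] coset_eq_iff[OF Y] by blast
qed

text \<open>The even-indexed vectors make the closed span infinite-dimensional. The odd-indexed functionals vanish
  on it, so the odd-indexed vectors remain biorthogonal, and thus independent, modulo it.\<close>

lemma halfspace_closed_span_biorthogonal:
  fixes h :: "nat \<Rightarrow> 'a::complex_normed_vector"
  assumes \<psi>: "\<And>n. clinear_functional (\<psi> n)" "\<And>n. \<psi> n (h n) \<noteq> 0" "\<And>m n. m \<noteq> n \<Longrightarrow> \<psi> n (h m) = 0"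
  shows "halfspace (closure (complex_vector.span (range (\<lambda>n. h (2 * n)))))"
proof -
  define V where "V = complex_vector.span (range (\<lambda>n. h (2 * n)))"
  define Y where "Y = closure V"
  have Y: "complex_vector.subspace Y"
    unfolding Y_def V_def by (intro complex_subspace_closure complex_vector.subspace_span)
  have hY: "h (2 * n) \<in> Y" for n
  proof -
    have "h (2 * n) \<in> V" unfolding V_def by (rule complex_vector.span_base) simp
    then show ?thesis using closure_subset unfolding Y_def by blast
  qed
  have "infinite_dim Y"
    unfolding infinite_dim_def
  proof
    assume "\<exists>B. finite B \<and> complex_vector.span B = Y"
    then obtain B where B: "finite B" "complex_vector.span B = Y" by blast
    have "\<not> range (\<lambda>n. h (2 * n)) \<subseteq> complex_vector.span B"
      by (rule biorthogonal_not_in_finite_span[of "\<lambda>n. \<psi> (2 * n)"]) (use \<psi> B(1) in auto)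
    then show False using hY B(2) by blast
  qed
  moreover have "infinite_dim_quotient Y"
    unfolding infinite_dim_quotient_def
  proof
    assume "\<exists>S. finite S \<and> S \<subseteq> quotient_space Y \<and> quotient_span Y S = quotient_space Y"
    then obtain S where S: "finite S" "S \<subseteq> range (coset Y)" "quotient_span Y S = range (coset Y)"
      by (auto simp: quotient_space_def)
    obtain B where B: "finite B" "S = coset Y ` B"
      using finite_subset_image[OF S(1,2)] by blast
    have "\<exists>b\<in>complex_vector.span B. h (2 * n + 1) - b \<in> Y" for n
      using quotient_span_representative[OF Y, of "coset Y (h (2 * n + 1))" B] S(3) B(2)
      by (auto simp: coset_eq_iff[OF Y])
    then obtain b where b: "\<And>n. b n \<in> complex_vector.span B" "\<And>n. h (2 * n + 1) - b n \<in> Y" by metis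
    have \<psi>Y: "\<psi> (2 * k + 1) y = 0" if "y \<in> Y" for k y
    proof -
      have "V \<subseteq> {z. \<psi> (2 * k + 1) z = 0}"
        unfolding V_def
        by (rule complex_vector.span_minimal[OF _ subspace_kernel[OF \<psi>(1)]]) 
          (auto intro!: \<psi>(3), presburger)
      moreover have "closed {z. \<psi> (2 * k + 1) z = 0}"
        using clinear_functionalD(1)[OF \<psi>(1)]
        by (intro closed_Collect_eq continuous_on_const linear_continuous_on)
      ultimately have "Y \<subseteq> {z. \<psi> (2 * k + 1) z = 0}" unfolding Y_def by (rule closure_minimal)
      then show ?thesis using that by blast
    qed
    have \<psi>b: "\<psi> (2 * k + 1) (b n) = \<psi> (2 * k + 1) (h (2 * n + 1))" for k n
      using \<psi>Y[OF b(2)[of n], of k] by (simp add: clinear_functionalD(4)[OF \<psi>(1)])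
    have "\<not> range b \<subseteq> complex_vector.span B"
      by (rule biorthogonal_not_in_finite_span[of "\<lambda>n. \<psi> (2 * n + 1)"])
        (use \<psi> \<psi>b B(1) in auto)
    then show False using b(1) by blast
  qed
  ultimately show ?thesis using Y by (simp add: halfspace_def Y_def V_def)
qed

section \<open>Invariant halfspaces of rank-one perturbations\<close>

theorem theorem2p11:
  fixes T :: "'a::complex_banach \<Rightarrow>\<^sub>L 'a" and x :: 'a and \<epsilon> :: real
  assumes "infinite_dim (UNIV :: 'a set)"
    and "T \<in> bounded_operators"
    and "countable (spectrum T)"
    and "point_spectrum T = {}"
    and "x \<noteq> 0"
    and "\<epsilon> > 0"
  shows "\<exists>F\<in>bounded_operators. norm F < \<epsilon> \<and>
    range (blinfun_apply F) = complex_vector.span {x} \<and>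
    (\<exists>Y. invariant_halfspace (T - F) Y \<and>
      blinfun_apply T ` Y \<subseteq> {y + z | y z. y \<in> Y \<and> z \<in> complex_vector.span {x}})"
proof -
  note T = assms(2-4)
  \<comment> \<open>The factor \<open>2\<close> turns the bound \<open>norm F \<le> \<epsilon> / 2\<close> into the required strict inequality.\<close>
  have "\<epsilon> / (2 * norm x) > 0" using assms(5,6) by simp
  then obtain \<phi> where \<phi>: "clinear_functional \<phi>" "\<And>z. cmod (\<phi> z) \<le> \<epsilon> / (2 * norm x) * norm z"
    and inf: "infinite {m. m \<notin> spectrum T \<and> \<phi> (blinfun_apply (resolvent T m) x) = 1 \<and>
      \<phi> (blinfun_apply (resolvent T m) (blinfun_apply (resolvent T m) x)) \<noteq> 0}"
    using simple_rank_one_eigenvalues[OF T assms(5)] by blast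
  obtain \<mu> :: "nat \<Rightarrow> complex" where "inj \<mu>" and
    "range \<mu> \<subseteq> {m. m \<notin> spectrum T \<and> \<phi> (blinfun_apply (resolvent T m) x) = 1 \<and>
      \<phi> (blinfun_apply (resolvent T m) (blinfun_apply (resolvent T m) x)) \<noteq> 0}"
    using infinite_countable_subset[OF inf] by blast
  define h where "h n = blinfun_apply (resolvent T (\<mu> n)) x" for n
  define \<psi> where "\<psi> n z = \<phi> (blinfun_apply (resolvent T (\<mu> n)) z)" for n z
  have \<mu>: "\<mu> n \<notin> spectrum T" "\<phi> (h n) = 1" "\<psi> n (h n) \<noteq> 0" for n
    using \<open>range \<mu> \<subseteq> _\<close> by (auto simp: h_def \<psi>_def)
  note \<phi>D = clinear_functionalD[OF \<phi>(1)]
  have \<psi>: "clinear_functional (\<psi> n)" for n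
    unfolding clinear_functional_def \<psi>_def
    by (auto simp: bounded_operators_scaleC[OF resolvent(1)[OF \<mu>(1)]] \<phi>D(2)
        intro: bounded_linear_compose[OF \<phi>D(1) blinfun.bounded_linear_right])
  have biorth: "\<psi> n (h m) = 0" if "m \<noteq> n" for m n
  proof -
    have "(\<mu> m - \<mu> n) * \<psi> n (h m) = \<phi> (h n - h m)"
      using resolvent_identity[OF \<mu>(1)[of n] \<mu>(1)[of m], of x] by (simp add: h_def \<psi>_def \<phi>D(2))
    then show ?thesis using \<open>inj \<mu>\<close> that by (simp add: \<phi>D(4) \<mu>(2) inj_eq)
  qed
  have blF: "bounded_linear (\<lambda>z. - (\<phi> z *\<^sub>C x))"
    by (intro bounded_linear_minus bounded_linear_compose[OF bounded_bilinear.bounded_linear_left[OF bounded_bilinear_scaleC] \<phi>D(1)])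
  define F where "F = Blinfun (\<lambda>z. - (\<phi> z *\<^sub>C x))"
  have F: "blinfun_apply F z = - (\<phi> z *\<^sub>C x)" for z
    using blF by (simp add: F_def bounded_linear_Blinfun_apply)
  have F_op: "F \<in> bounded_operators"
    by (simp add: bounded_operators_iff F \<phi>D(2) scaleC_scaleC)
  have "norm F \<le> \<epsilon> / 2"
  proof (rule norm_blinfun_bound)
    show "norm (blinfun_apply F z) \<le> \<epsilon> / 2 * norm z" for z
      using mult_right_mono[OF \<phi>(2)[of z], of "norm x"] assms(5) by (simp add: F norm_scaleC)
  qed (use assms(6) in simp)
  then have F_norm: "norm F < \<epsilon>" using assms(6) by simp
  have F_range: "range (blinfun_apply F) = complex_vector.span {x}"
    unfolding complex_vector.span_singleton
  proof (intro equalityI subsetI)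
    fix u assume "u \<in> range (blinfun_apply F)"
    then show "u \<in> range (\<lambda>k. k *\<^sub>C x)" by (auto simp: F simp flip: complex_vector.scale_minus_left)
  next
    fix u assume "u \<in> range (\<lambda>k. k *\<^sub>C x)"
    then obtain k where "u = k *\<^sub>C x" by blast
    then have "u = blinfun_apply F ((- k) *\<^sub>C h 0)" by (simp add: F \<phi>D(2,6) \<mu>(2))
    then show "u \<in> range (blinfun_apply F)" by blast
  qed
  have R_scale: "blinfun_apply (T - F) (c *\<^sub>C z) = c *\<^sub>C blinfun_apply (T - F) z" for c z
    by (simp add: blinfun.diff_left bounded_operators_scaleC[OF T(1)] bounded_operators_scaleC[OF F_op]
        complex_vector.scale_right_diff_distrib)
  \<comment> \<open>\<open>T (h n) = \<mu> n *\<^sub>C h n - x\<close> and \<open>F (h n) = - x\<close>.\<close>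
  have eigen: "blinfun_apply (T - F) (h n) = \<mu> n *\<^sub>C h n" for n
    using resolvent(3)[OF \<mu>(1), of n x]
    by (simp add: blinfun.diff_left F \<mu>(2) scaleC_one flip: h_def) (metis add.commute diff_add_cancel)
  define V where "V = complex_vector.span (range (\<lambda>n. h (2 * n)))"
  have "V \<subseteq> {z. blinfun_apply (T - F) z \<in> V}"
    unfolding V_def
  proof (rule complex_vector.span_minimal)
    show "range (\<lambda>n. h (2 * n)) \<subseteq> {z. blinfun_apply (T - F) z \<in> complex_vector.span (range (\<lambda>n. h (2 * n)))}"
      by (auto simp: eigen intro!: complex_vector.span_scale[OF complex_vector.span_base])
    show "complex_vector.subspace {z. blinfun_apply (T - F) z \<in> complex_vector.span (range (\<lambda>n. h (2 * n)))}"
      by (rule complex_vector.subspaceI)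
        (auto simp: R_scale blinfun.add_right complex_vector.span_zero
          intro: complex_vector.span_add complex_vector.span_scale)
  qed
  then have "blinfun_apply (T - F) ` V \<subseteq> closure V" using closure_subset by blast
  then have inv: "blinfun_apply (T - F) ` closure V \<subseteq> closure V"
    by (intro image_closure_subset) (auto intro: linear_continuous_on blinfun.bounded_linear_right)
  have "halfspace (closure V)"
    unfolding V_def by (rule halfspace_closed_span_biorthogonal[of \<psi>]) (use \<psi> \<mu>(3) biorth in auto)
  then have "invariant_halfspace (T - F) (closure V)"
    using inv by (simp add: invariant_halfspace_def)
  moreover have "blinfun_apply T ` closure V \<subseteq> {y + z | y z. y \<in> closure V \<and> z \<in> complex_vector.span {x}}"
  proof
    fix u assume "u \<in> blinfun_apply T ` closure V"
    then obtain y where y: "y \<in> closure V" "u = blinfun_apply T y" by blast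
    then have "u = blinfun_apply (T - F) y + blinfun_apply F y" by (simp add: blinfun.diff_left)
    moreover have "blinfun_apply (T - F) y \<in> closure V" using inv y(1) by blast
    moreover have "blinfun_apply F y \<in> complex_vector.span {x}" using F_range by blast
    ultimately show "u \<in> {y + z | y z. y \<in> closure V \<and> z \<in> complex_vector.span {x}}" by blast
  qed
  ultimately show ?thesis using F_op F_norm F_range by blast
qed

end
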